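(* For positive integers $k,d$ let $\Phi_k(d)$ be the smallest $r$ for which a $\mathcal W_k(r,d)$ set exists, and for positive integers $e\mid d$ let $\Theta_e(d) = 1+\min_{t\in\mathbb N}\left(t\cdot\frac de+\left\lfloor \frac et\right\rfloor\right)$. Then: (1) $\Phi_{k+1}(d)\le \Phi_k(d)$ for all $k,d$. (2) $\Phi_k(2)=3$ for all $k\ge 2$. (3) $\Phi_k(d)\ge 4$ for all $d\ge 3$ and all $k$. (4) $\Phi_k(d) > 1+\sqrt{d+1}$ for all $d\ge 3$ and all $k$. (5) $\Phi_d(d)\le \Theta_d(d) = 1+\lfloor\sqrt{4d+1}\rfloor$ for all $d$. (6) If $e\mid d$, then $\Phi_e(d)\le \min\{\Theta_k(d) : k\le e,\ k\mid d\}$. (7) $\Phi_k(d)=4$ for $d=3,4,5$ and all $k\ge 2$. (8) $\Phi_2(d)\ge 5$ for all $d\ge 6$. (9) $\Phi_2(d)=5$ for $d=6,7$. (10) $\Phi_2(14)\le 6$. (11) $\Phi_2(d)\le \lfloor d/2\rfloor+2$ for all $d\ge 4$.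
   Context: $\mathbb N=\{1,2,\dots\}$. $H_k(\mathbb C^2)$ is the $(k+1)$-dimensional complex vector space of binary forms (homogeneous polynomials in $x,y$) of degree $k$ with complex coefficients. A set $\{f_1,\dots,f_r\}\subset H_k(\mathbb C^2)$ of nonzero forms is honest if its elements are pairwise non-proportional. An honest set $\{f_1,\dots,f_r\}\subset H_k(\mathbb C^2)$ is called a $\mathcal W_k(r,d)$ set if $\{f_1^d,\dots,f_r^d\}$ is linearly dependent over $\mathbb C$. *)

theory Defs
  imports Complex_Main "HOL-Computational_Algebra.Polynomial"
begin

text \<open>
  The ring of polynomials in \<open>x, y\<close> over the complex numbers is rendered as the library ring
  \<^typ>\<open>complex poly poly\<close>, with \<open>y\<close> the outer variable: the coefficient of \<open>x ^ i * y ^ j\<close> in \<open>f\<close>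
  is \<open>coeff (coeff f j) i\<close>.
\<close>

definition bscale :: "complex \<Rightarrow> complex poly poly \<Rightarrow> complex poly poly" where
  "bscale c f = smult [:c:] f"

global_interpretation bpoly: vector_space bscale
  by unfold_locales (simp_all add: bscale_def smult_add_right mult.commute flip: smult_add_left one_pCons)

definition binary_forms :: "nat \<Rightarrow> complex poly poly set" where
  "binary_forms k = {f. \<forall>i j. coeff (coeff f j) i \<noteq> 0 \<longrightarrow> i + j = k}"

definition proportional :: "complex poly poly \<Rightarrow> complex poly poly \<Rightarrow> bool" where
  "proportional f g \<longleftrightarrow> (\<exists>c. c \<noteq> 0 \<and> f = bscale c g)"

definition honest :: "nat \<Rightarrow> complex poly poly set \<Rightarrow> bool" where
  "honest k F \<longleftrightarrow> finite F \<and> F \<subseteq> binary_forms k \<and> 0 \<notin> F \<and> pairwise (\<lambda>f g. \<not> proportional f g) F"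

text \<open>
  For \<open>d > 0\<close> the map \<open>f \<mapsto> f ^ d\<close> is injective on an honest set (equal powers force proportional
  forms), so dependence of the set of powers and of the family of powers coincide.
\<close>

definition W_set :: "nat \<Rightarrow> nat \<Rightarrow> nat \<Rightarrow> complex poly poly set \<Rightarrow> bool" where
  "W_set k r d F \<longleftrightarrow> honest k F \<and> card F = r \<and> bpoly.dependent ((\<lambda>f. f ^ d) ` F)"

text \<open>
  For \<open>k, d > 0\<close> some \<open>r\<close> exists: there are infinitely many pairwise non-proportional forms of
  degree \<open>k\<close>, and the powers of any \<open>k * d + 2\<close> of them lie in a space of dimension \<open>k * d + 1\<close>.
\<close>

definition \<Phi> :: "nat \<Rightarrow> nat \<Rightarrow> nat" where
  "\<Phi> k d = (LEAST r. \<exists>F. W_set k r d F)"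

text \<open>
  Intended for \<open>e dvd d\<close>, where \<open>d div e\<close> is the exact quotient; \<open>e div t\<close> is the floor of the
  quotient. An infimum of a nonempty set of natural numbers is its minimum.
\<close>

definition \<Theta> :: "nat \<Rightarrow> nat \<Rightarrow> nat" where
  "\<Theta> e d = 1 + (INF t\<in>{1..}. t * (d div e) + e div t)"

end

theory Submission
  imports Defs "HOL-Computational_Algebra.Fundamental_Theorem_Algebra"
    "HOL-Computational_Algebra.Field_as_Ring" "Jordan_Normal_Form.Determinant"
begin

text \<open>
  Setting \<open>y = 1\<close> identifies the forms of degree \<open>k\<close> with the univariate polynomials of degree at
  most \<open>k\<close> and respects products and linear combinations, so \<open>\<Phi> k d\<close> is the least size of a set
  of pairwise non-proportional polynomials of degree at most \<open>k\<close> whose \<open>d\<close>-th powers are dependent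
  (\<open>ex_W_set_iff\<close>). In this form \<open>\<Phi>\<close> is visibly decreasing in \<open>k\<close>: the degree bound only relaxes.

  The lower bounds come from one inequality (\<open>circuit_degree_inequality\<close>) of Mason-Stothers type.
  Take a minimal dependent family \<open>g\<^sub>0\<^sup>d, \<dots>, g\<^sub>n\<^sup>d\<close>, divide out the common factor of the \<open>g\<^sub>i\<close>, and
  consider the Wronskian \<open>W\<close> of \<open>n\<close> of the powers. It is nonzero, and the linear relation shows
  that \<open>W\<close> is the same up to a constant whichever power is left out. At a given point some
  \<open>g\<^sub>k\<close> does not vanish; leaving that one out, a zero of order \<open>a\<close> of another \<open>g\<^sub>i\<close> contributes at least
  \<open>a d - (n - 1) \<ge> a (d + 1 - n)\<close> to the order of \<open>W\<close>. Hence the degree of \<open>W\<close> is at least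
  \<open>(d + 1 - n)\<close> times the total degree of the \<open>g\<^sub>i\<close>. From above, expanding \<open>W\<close> in monomials leaves
  only terms with pairwise distinct exponents \<open>e\<^sub>i \<le> d deg g\<^sub>i\<close>, of degree
  \<open>e\<^sub>0 + \<dots> + e\<^bsub>n-1\<^esub> - n(n-1)/2\<close>. Ignoring that the exponents are distinct already gives \<open>d + 1 < n\<^sup>2\<close>,
  whence the bounds by \<open>4\<close> and by \<open>1 + sqrt (d + 1)\<close>. For quadratic forms and \<open>d \<ge> 6\<close>, the term
  \<open>n(n-1)/2\<close> sharpens this so far that, among \<open>n \<le> 3\<close>, only \<open>n = 3\<close>, \<open>d = 6\<close> is left, and
  distinctness of the exponents rules that out.

  The upper bounds are explicit. Averaging \<open>(x\<^sup>e + \<omega>\<^sup>j y\<^sup>e)\<^sup>d\<close> over the \<open>m\<close>-th roots of unity, with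
  \<open>m = t d / e\<close>, leaves only monomials that are themselves \<open>d\<close>-th powers of monomials of degree
  \<open>e\<close> (\<open>roots_of_unity_family\<close>). For quadratic forms, the rotations \<open>x \<mapsto> \<omega>\<^sup>j x\<close> of one form
  \<open>x\<^sup>2 + \<alpha> x y + \<beta> y\<^sup>2\<close> have \<open>d\<close>-th powers which, suitably weighted, add up to a multiple of
  \<open>(x y)\<^sup>d\<close> as soon as the coefficients of the other surviving monomials vanish
  (\<open>Phi_2_le_rotation_orbit\<close>). With \<open>m = d div 2 + 1\<close> there is, by symmetry, a single condition on
  \<open>\<alpha>\<close>, solvable by the fundamental theorem of algebra; with \<open>d = 14\<close>, \<open>m = 5\<close> and
  \<open>x\<^sup>2 + x y - y\<^sup>2\<close> one finds the six axes of the icosahedron. Small cases use classical identities.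
\<close>

hide_const (open) Module.smult

section \<open>Wronskians of polynomials\<close>

definition wronskian :: "nat \<Rightarrow> (nat \<Rightarrow> complex poly) \<Rightarrow> complex poly" where
  "wronskian n u = det (mat\<^sub>r n n (\<lambda>i. vec n (\<lambda>j. (pderiv ^^ j) (u i))))"

lemma wronskian_leibniz:
  "wronskian n u = (\<Sum>p | p permutes {0..<n}. signof p * (\<Prod>i<n. (pderiv ^^ p i) (u i)))"
proof -
  have "(\<Prod>i = 0..<n. mat\<^sub>r n n (\<lambda>i. vec n (\<lambda>j. (pderiv ^^ j) (u i))) $$ (i, p i))
      = (\<Prod>i<n. (pderiv ^^ p i) (u i))" if "p permutes {0..<n}" for p
    unfolding atLeast0LessThan
  proof (rule prod.cong)
    fix i assume "i \<in> {..<n}"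
    then have "i < n" "p i < n"
      using permutes_in_image[OF that, of i] by auto
    then show "mat\<^sub>r n n (\<lambda>i. vec n (\<lambda>j. (pderiv ^^ j) (u i))) $$ (i, p i) = (pderiv ^^ p i) (u i)"
      by simp
  qed simp
  then show ?thesis
    unfolding wronskian_def by (subst det_def'[of _ n]) (auto intro!: sum.cong)
qed

lemma wronskian_cong: "(\<And>i. i < n \<Longrightarrow> u i = v i) \<Longrightarrow> wronskian n u = wronskian n v"
  unfolding wronskian_leibniz by (intro sum.cong refl arg_cong2[where f="(*)"] prod.cong) auto

lemma vec_sum:
  fixes h :: "'b \<Rightarrow> nat \<Rightarrow> 'a :: comm_ring_1"
  assumes "finite S"
  shows "vec n (\<lambda>j. \<Sum>s\<in>S. h s j) = finsum_vec TYPE('a) n (\<lambda>s. vec n (h s)) S"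
proof (rule eq_vecI)
  have "finsum_vec TYPE('a) n (\<lambda>s. vec n (h s)) S \<in> carrier_vec n"
    by (rule finsum_vec_closed) auto
  then show d: "dim_vec (vec n (\<lambda>j. \<Sum>s\<in>S. h s j)) = dim_vec (finsum_vec TYPE('a) n (\<lambda>s. vec n (h s)) S)"
    by simp
  fix i assume "i < dim_vec (finsum_vec TYPE('a) n (\<lambda>s. vec n (h s)) S)"
  then show "vec n (\<lambda>j. \<Sum>s\<in>S. h s j) $ i = finsum_vec TYPE('a) n (\<lambda>s. vec n (h s)) S $ i"
    using d by (simp add: index_finsum_vec[OF assms])
qed

lemma smult_sum_dist: "smult c (\<Sum>x\<in>S. f x) = (\<Sum>x\<in>S. smult c (f x :: complex poly))"
  by (induction S rule: infinite_finite_induct) (simp_all add: smult_add_right)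

lemma wronskian_scale:
  "wronskian n (\<lambda>i. smult (c i) (u i)) = smult (\<Prod>i<n. c i) (wronskian n u)"
  by (simp add: wronskian_leibniz higher_pderiv_smult prod_smult smult_sum_dist)

lemma wronskian_sum:
  fixes S :: "nat set"
  assumes "finite S"
  shows "wronskian n (\<lambda>i. \<Sum>s\<in>S. a i s)
    = (\<Sum>f | (\<forall>i\<in>{0..<n}. f i \<in> S) \<and> (\<forall>i. i \<notin> {0..<n} \<longrightarrow> f i = i). wronskian n (\<lambda>i. a i (f i)))"
proof -
  let ?a = "\<lambda>i s. vec n (\<lambda>j. (pderiv ^^ j) (a i s))"
  have "vec n (\<lambda>j. (pderiv ^^ j) (\<Sum>s\<in>S. a i s)) = finsum_vec TYPE(complex poly) n (?a i) S" for i
    unfolding higher_pderiv_sum by (rule vec_sum[OF assms])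
  then show ?thesis
    unfolding wronskian_def
    by (simp add: det_linear_rows_sum[OF assms, where a = ?a])
qed

lemma wronskian_upd_sum:
  assumes "finite S" "k < n"
  shows "wronskian n (u(k := (\<Sum>s\<in>S. a s))) = (\<Sum>s\<in>S. wronskian n (u(k := a s)))"
proof -
  let ?v = "\<lambda>p. vec n (\<lambda>j. (pderiv ^^ j) p)"
  have *: "?v ((u(k := p)) i) = (if i = k then ?v p else ?v (u i))" for p i by simp
  have **: "?v (\<Sum>s\<in>S. a s) = finsum_vec TYPE(complex poly) n (\<lambda>s. ?v (a s)) S"
    unfolding higher_pderiv_sum by (rule vec_sum[OF assms(1)])
  show ?thesis
    unfolding wronskian_def * **
    by (rule det_linear_row_finsum[where a = "\<lambda>_ s. ?v (a s)"]) (use assms in auto)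
qed

lemma wronskian_eq_rows:
  assumes "i < n" "j < n" "i \<noteq> j" "u i = u j"
  shows "wronskian n u = 0"
  unfolding wronskian_def
  by (rule det_identical_rows[of _ n i j]) (use assms in auto)

text \<open>
  Since the functions sum to zero, replacing row \<open>k\<close> by their sum kills the determinant; expanding
  that row, only the original row \<open>k\<close> and the last function avoid a repeated row. So leaving out a
  different member of a dependency changes the Wronskian only by a sign.
\<close>

lemma wronskian_replace:
  assumes "(\<Sum>i\<le>n. u i) = 0" "k < n"
  shows "wronskian n (u(k := u n)) = - wronskian n u"
proof -
  \<comment> \<open>the row \<open>k\<close> is zero here, which is the additivity law for an empty sum\<close>
  have "0 = wronskian n (u(k := (\<Sum>i\<le>n. u i)))"
    using wronskian_upd_sum[of "{}" k n u "\<lambda>_. 0"] assms by simp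
  also have "\<dots> = (\<Sum>i\<le>n. wronskian n (u(k := u i)))"
    using assms by (intro wronskian_upd_sum) auto
  also have "\<dots> = (\<Sum>i\<in>{k, n}. wronskian n (u(k := u i)))"
  proof (rule sum.mono_neutral_right)
    show "\<forall>i\<in>{..n} - {k, n}. wronskian n (u(k := u i)) = 0"
    proof
      fix i assume "i \<in> {..n} - {k, n}"
      then show "wronskian n (u(k := u i)) = 0"
        using assms(2) by (intro wronskian_eq_rows[of i n k]) auto
    qed
  qed (use assms in auto)
  also have "\<dots> = wronskian n u + wronskian n (u(k := u n))"
    using assms(2) by simp
  finally show ?thesis by (simp add: eq_neg_iff_add_eq_0 add.commute)
qed

lemma power_dvd_pderiv:
  assumes "q ^ m dvd (f :: complex poly)"
  shows "q ^ (m - 1) dvd pderiv f"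
proof -
  obtain h where "f = q ^ m * h" using assms by (elim dvdE)
  then have "pderiv f = q ^ m * pderiv h + h * pderiv (q ^ m)" by (simp add: pderiv_mult)
  moreover have "q ^ (m - 1) dvd q ^ m" by (rule le_imp_power_dvd) simp
  moreover have "q ^ (m - 1) dvd pderiv (q ^ m)"
    by (cases m) (simp_all add: pderiv_power_Suc dvd_smult del: power_Suc)
  ultimately show ?thesis by (simp add: dvd_add dvd_mult dvd_mult2)
qed

lemma power_dvd_pderiv_iter:
  "q ^ m dvd (f :: complex poly) \<Longrightarrow> q ^ (m - j) dvd (pderiv ^^ j) f"
proof (induction j)
  case (Suc j)
  then show ?case using power_dvd_pderiv[of q "m - j" "(pderiv ^^ j) f"] by simp
qed simp

text \<open>
  A zero of order \<open>m i\<close> loses at most \<open>n - 1\<close> under the derivatives that occur, uniformly over each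
  row, so every term of the Leibniz expansion has the stated power as a factor.
\<close>

lemma power_dvd_wronskian:
  assumes "\<And>i. i < n \<Longrightarrow> q ^ m i dvd u i"
  shows "q ^ (\<Sum>i<n. m i - (n - 1)) dvd wronskian n u"
  unfolding wronskian_leibniz power_sum
proof (intro dvd_sum dvd_mult prod_dvd_prod)
  fix p i assume "p \<in> {p. p permutes {0..<n}}" "i \<in> {..<n}"
  then have "i < n" "p i < n"
    using permutes_in_image[of p "{0..<n}" i] by simp_all
  then have "q ^ (m i - (n - 1)) dvd q ^ (m i - p i)"
    by (intro le_imp_power_dvd) auto
  also have "\<dots> dvd (pderiv ^^ p i) (u i)"
    using power_dvd_pderiv_iter assms \<open>i < n\<close> by blast
  finally show "q ^ (m i - (n - 1)) dvd (pderiv ^^ p i) (u i)" .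
qed

lemma degree_higher_pderiv_add_le:
  "(pderiv ^^ j) (f :: complex poly) \<noteq> 0 \<Longrightarrow> degree ((pderiv ^^ j) f) + j \<le> degree f"
proof (induction j)
  case (Suc j)
  then have "(pderiv ^^ j) f \<noteq> 0" "degree ((pderiv ^^ j) f) \<noteq> 0"
    by (auto simp: pderiv_eq_0_iff)
  with Suc show ?case by (simp add: degree_pderiv)
qed simp

text \<open>
  A term of the Leibniz expansion differentiates the functions \<open>0, \<dots>, n - 1\<close> times in some order, and
  each differentiation lowers the degree by one or kills the term.
\<close>

lemma degree_wronskian_le:
  assumes "wronskian n u \<noteq> 0"
  shows "degree (wronskian n u) + (\<Sum>i<n. i) \<le> (\<Sum>i<n. degree (u i))"
proof -
  have "degree (signof p * (\<Prod>i<n. (pderiv ^^ p i) (u i))) + (\<Sum>i<n. i) \<le> (\<Sum>i<n. degree (u i))"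
    if p: "p permutes {0..<n}" and nz: "signof p * (\<Prod>i<n. (pderiv ^^ p i) (u i)) \<noteq> 0" for p
  proof -
    have "degree (signof p * (\<Prod>i<n. (pderiv ^^ p i) (u i))) = (\<Sum>i<n. degree ((pderiv ^^ p i) (u i)))"
      using nz by (simp add: sign_def degree_mult_eq degree_prod_eq_sum_degree split: if_splits)
    moreover have "(\<Sum>i<n. i) = (\<Sum>i<n. p i)"
      using sum.permute[OF p, of "\<lambda>i. i"] by (simp add: atLeast0LessThan)
    moreover have "(\<Sum>i<n. degree ((pderiv ^^ p i) (u i)) + p i) \<le> (\<Sum>i<n. degree (u i))"
      using nz by (intro sum_mono degree_higher_pderiv_add_le) auto
    ultimately show ?thesis by (simp add: sum.distrib)
  qed
  moreover obtain p where p: "p permutes {0..<n}"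
    "degree (wronskian n u) \<le> degree (signof p * (\<Prod>i<n. (pderiv ^^ p i) (u i)))"
    "signof p * (\<Prod>i<n. (pderiv ^^ p i) (u i)) \<noteq> 0"
  proof -
    have "coeff (wronskian n u) (degree (wronskian n u)) \<noteq> 0" using assms by simp
    then obtain p where "p permutes {0..<n}"
      "coeff (signof p * (\<Prod>i<n. (pderiv ^^ p i) (u i))) (degree (wronskian n u)) \<noteq> 0"
      by (subst (asm) wronskian_leibniz, unfold coeff_sum)
        (erule sum.not_neutral_contains_not_neutral, simp)
    moreover from this have "signof p * (\<Prod>i<n. (pderiv ^^ p i) (u i)) \<noteq> 0"
      by (metis coeff_0)
    ultimately show ?thesis using that le_degree by blast
  qed
  ultimately show ?thesis by (meson add_le_mono1 le_trans)
qed

text \<open>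
  By multilinearity the Wronskian is a combination of Wronskians of monomials, and those with a
  repeated exponent vanish. The exponents \<open>e\<close> are those of a term that reaches the full degree.
  Distinctness is the gain over the plain degree bound.
\<close>

lemma wronskian_distinct_exponents:
  assumes "wronskian n u \<noteq> 0"
  obtains e where "inj_on e {..<n}" "\<And>i. i < n \<Longrightarrow> e i \<le> degree (u i)"
    "degree (wronskian n u) + (\<Sum>i<n. i) \<le> (\<Sum>i<n. e i)"
proof -
  define N where "N = (\<Sum>i<n. degree (u i))"
  have N: "degree (u i) \<le> N" if "i < n" for i
    unfolding N_def using that by (intro member_le_sum) auto
  let ?a = "\<lambda>i s. smult (coeff (u i) s) (monom 1 s)"
  let ?V = "\<lambda>e. wronskian n (\<lambda>i. monom 1 (e i))"
  have "wronskian n u = wronskian n (\<lambda>i. \<Sum>s\<le>N. ?a i s)"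
    using N by (intro wronskian_cong) (simp add: poly_as_sum_of_monoms' smult_monom)
  also have "\<dots> = (\<Sum>e | (\<forall>i\<in>{0..<n}. e i \<in> {..N}) \<and> (\<forall>i. i \<notin> {0..<n} \<longrightarrow> e i = i).
      smult (\<Prod>i<n. coeff (u i) (e i)) (?V e))"
    by (subst wronskian_sum) (simp_all add: wronskian_scale)
  finally have W: "wronskian n u = \<dots>" .
  have "coeff (wronskian n u) (degree (wronskian n u)) \<noteq> 0" using assms by simp
  then obtain e where *: "coeff (smult (\<Prod>i<n. coeff (u i) (e i)) (?V e)) (degree (wronskian n u)) \<noteq> 0"
    by (subst (asm) W, unfold coeff_sum) (meson sum.not_neutral_contains_not_neutral)
  then have e: "degree (wronskian n u) \<le> degree (?V e)" "?V e \<noteq> 0"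
    by (auto intro: le_degree)
  show thesis
  proof (rule that)
    show "inj_on e {..<n}"
    proof (rule inj_onI, rule ccontr)
      fix i j assume "i \<in> {..<n}" "j \<in> {..<n}" "e i = e j" "i \<noteq> j"
      then show False
        using e(2) wronskian_eq_rows[of i n j "\<lambda>i. monom 1 (e i)"] by simp
    qed
    show "e i \<le> degree (u i)" if "i < n" for i
      using * that by (auto intro: le_degree)
    show "degree (wronskian n u) + (\<Sum>i<n. i) \<le> (\<Sum>i<n. e i)"
      using degree_wronskian_le[OF e(2)] e(1) by (simp add: degree_monom_eq)
  qed
qed

text \<open>
  This says that a quotient with zero derivative is constant. To stay within polynomials, the common
  factor is removed; then \<open>q\<close> divides its own derivative, and so does \<open>p\<close>.
\<close>

lemma parallel_derivatives_imp_proportional: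
  fixes p q :: "complex poly"
  assumes eq: "p * pderiv q = pderiv p * q" and "q \<noteq> 0"
  shows "\<exists>c. p = smult c q"
proof -
  define h where "h = gcd p q"
  have "h \<noteq> 0" using \<open>q \<noteq> 0\<close> by (simp add: h_def)
  obtain p1 q1 where pq: "p = h * p1" "q = h * q1"
    unfolding h_def by (meson dvdE gcd_dvd1 gcd_dvd2)
  have "coprime p1 q1"
    using \<open>q \<noteq> 0\<close> pq unfolding h_def
    by (metis coprime_iff_gcd_eq_1 div_gcd_coprime gcd_eq_0_iff nonzero_mult_div_cancel_left)
  have "h * h * (p1 * pderiv q1) = h * h * (pderiv p1 * q1)"
    using eq unfolding pq pderiv_mult by (simp add: algebra_simps)
  then have eq1: "p1 * pderiv q1 = pderiv p1 * q1"
    using \<open>h \<noteq> 0\<close> by simp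
  have "q1 dvd p1 * pderiv q1" "p1 dvd pderiv p1 * q1"
    by (metis eq1 dvd_triv_right, metis eq1 dvd_triv_left)
  then have "q1 dvd pderiv q1" "p1 dvd pderiv p1"
    using \<open>coprime p1 q1\<close>
    by (simp_all add: coprime_dvd_mult_right_iff coprime_dvd_mult_left_iff coprime_commute)
  then have "pderiv q1 = 0" "pderiv p1 = 0"
    using not_dvd_pderiv pderiv_eq_0_iff by blast+
  then obtain a b where ab: "p1 = [:a:]" "q1 = [:b:]"
    by (metis degree_eq_zeroE pderiv_eq_0_iff)
  then have "b \<noteq> 0" using \<open>q \<noteq> 0\<close> pq by auto
  then have "p = smult (a / b) q" unfolding pq ab by simp
  then show ?thesis ..
qed

lemma det_eq_0_imp_left_kernel:
  fixes a :: "nat \<Rightarrow> nat \<Rightarrow> 'a :: idom"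
  assumes "det (mat\<^sub>r n n (\<lambda>i. vec n (a i))) = 0"
  obtains v where "\<exists>i<n. v i \<noteq> 0" "\<And>j. j < n \<Longrightarrow> (\<Sum>i<n. v i * a i j) = 0"
proof -
  let ?M = "mat\<^sub>r n n (\<lambda>i. vec n (a i))"
  have M: "transpose_mat ?M \<in> carrier_mat n n" by simp
  have "det (transpose_mat ?M) = 0"
    using assms by (subst det_transpose[of _ n]) auto
  then obtain v where v: "v \<in> carrier_vec n" "v \<noteq> 0\<^sub>v n" "transpose_mat ?M *\<^sub>v v = 0\<^sub>v n"
    using det_0_iff_vec_prod_zero[OF M] by auto
  show thesis
  proof (rule that)
    show "\<exists>i<n. v $ i \<noteq> 0"
      using v(1,2) by (metis carrier_vecD eq_vecI index_zero_vec(1) index_zero_vec(2))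
    fix j assume j: "j < n"
    then have "0 = (transpose_mat ?M *\<^sub>v v) $ j" using v(3) by simp
    also have "\<dots> = (\<Sum>i<n. v $ i * a i j)"
      using j v(1) by (simp add: scalar_prod_def atLeast0LessThan mult.commute)
    finally show "(\<Sum>i<n. v $ i * a i j) = 0" by simp
  qed
qed

text \<open>
  A vanishing determinant gives polynomials \<open>v i\<close>, not all zero, that annihilate every column of
  derivatives. If the smaller Wronskian is nonzero, then \<open>v n \<noteq> 0\<close>. Differentiating the relations
  shows that the \<open>v n * v i' - v n' * v i\<close> annihilate the smaller system, hence are zero, and
  the quotients \<open>v i / v n\<close> are constants.
\<close>

lemma wronskian_eq_0_imp_dependent:
  assumes "wronskian n u = 0"
  shows "\<exists>c. (\<exists>i<n. c i \<noteq> 0) \<and> (\<Sum>i<n. smult (c i) (u i)) = 0"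
  using assms
proof (induction n)
  case 0
  then show ?case by (simp add: wronskian_leibniz sign_id)
next
  case (Suc n)
  show ?case
  proof (cases "wronskian n u = 0")
    case True
    then obtain c i where c: "i < n" "c i \<noteq> 0" "(\<Sum>i<n. smult (c i) (u i)) = 0"
      using Suc.IH by blast
    have "(\<Sum>i<Suc n. smult ((c(n := 0)) i) (u i)) = 0"
      using c(3) by simp
    with c(1,2) show ?thesis by (intro exI[of _ "c(n := 0)"]) (auto intro!: exI[of _ i])
  next
    case False
    have kernel_trivial: "\<forall>i<n. v i = 0"
      if "\<And>j. j < n \<Longrightarrow> (\<Sum>i<n. v i * (pderiv ^^ j) (u i)) = 0" for v
    proof (rule ccontr)
      assume nz: "\<not> (\<forall>i<n. v i = 0)"
      let ?M = "mat\<^sub>r n n (\<lambda>i. vec n (\<lambda>j. (pderiv ^^ j) (u i)))"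
      have M: "transpose_mat ?M \<in> carrier_mat n n" by simp
      have "vec n v \<noteq> 0\<^sub>v n" using nz by (metis index_vec index_zero_vec(1))
      moreover have "transpose_mat ?M *\<^sub>v vec n v = 0\<^sub>v n"
        by (rule eq_vecI)
          (use that in \<open>auto simp: scalar_prod_def atLeast0LessThan mult.commute\<close>)
      ultimately have "det (transpose_mat ?M) = 0"
        using det_0_iff_vec_prod_zero[OF M] vec_carrier by blast
      then have "wronskian n u = 0"
        unfolding wronskian_def by (subst (asm) det_transpose[of _ n]) auto
      with False show False by contradiction
    qed
    obtain v where v: "\<exists>i<Suc n. v i \<noteq> 0"
      "\<And>j. j < Suc n \<Longrightarrow> (\<Sum>i<Suc n. v i * (pderiv ^^ j) (u i)) = 0"
      using det_eq_0_imp_left_kernel[OF Suc.prems[unfolded wronskian_def]] by blast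
    have "v n \<noteq> 0"
    proof
      assume "v n = 0"
      have "\<forall>i<n. v i = 0"
      proof (rule kernel_trivial)
        fix j assume "j < n"
        then show "(\<Sum>i<n. v i * (pderiv ^^ j) (u i)) = 0"
          using v(2)[of j] \<open>v n = 0\<close> by simp
      qed
      with \<open>v n = 0\<close> v(1) show False by (auto simp: less_Suc_eq)
    qed
    have shifted: "(\<Sum>i<Suc n. pderiv (v i) * (pderiv ^^ j) (u i)) = 0" if "j < n" for j
    proof -
      have "0 = pderiv (\<Sum>i<Suc n. v i * (pderiv ^^ j) (u i))"
        using v(2)[of j] that by simp
      also have "\<dots> = (\<Sum>i<Suc n. v i * (pderiv ^^ Suc j) (u i)) + (\<Sum>i<Suc n. pderiv (v i) * (pderiv ^^ j) (u i))"
        by (simp add: higher_pderiv_sum[of 1, simplified] pderiv_mult sum.distrib mult.commute del: sum.lessThan_Suc)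
      finally show ?thesis using v(2)[of "Suc j"] that by simp
    qed
    have "\<forall>i<n. v n * pderiv (v i) - pderiv (v n) * v i = 0"
    proof (rule kernel_trivial)
      fix j assume j: "j < n"
      have "(\<Sum>i<n. (v n * pderiv (v i) - pderiv (v n) * v i) * (pderiv ^^ j) (u i))
          = (\<Sum>i<Suc n. (v n * pderiv (v i) - pderiv (v n) * v i) * (pderiv ^^ j) (u i))"
        by (simp add: mult.commute)
      also have "\<dots> = v n * (\<Sum>i<Suc n. pderiv (v i) * (pderiv ^^ j) (u i))
          - pderiv (v n) * (\<Sum>i<Suc n. v i * (pderiv ^^ j) (u i))"
        by (simp only: sum_distrib_left left_diff_distrib sum_subtractf mult.assoc)
      also have "\<dots> = 0" using shifted[OF j] v(2)[of j] j by simp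
      finally show "(\<Sum>i<n. (v n * pderiv (v i) - pderiv (v n) * v i) * (pderiv ^^ j) (u i)) = 0" .
    qed
    then have parallel: "\<exists>c. v i = smult c (v n)" if "i < n" for i
      using that \<open>v n \<noteq> 0\<close> by (intro parallel_derivatives_imp_proportional) (auto simp: mult.commute)
    define c where "c i = (if i = n then 1 else SOME c. v i = smult c (v n))" for i
    have c: "smult (c i) (v n) = v i" if "i < Suc n" for i
    proof (cases "i = n")
      case False
      with that have "i < n" by simp
      from someI_ex[OF parallel[OF this]] show ?thesis using False by (simp add: c_def)
    qed (simp add: c_def)
    have "v n * (\<Sum>i<Suc n. smult (c i) (u i)) = (\<Sum>i<Suc n. smult (c i) (v n) * u i)"
      unfolding sum_distrib_left by (intro sum.cong refl) simp
    also have "\<dots> = (\<Sum>i<Suc n. v i * u i)"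
      by (intro sum.cong refl arg_cong2[where f = "(*)"] c) simp
    also have "\<dots> = 0" using v(2)[of 0] by simp
    finally have "(\<Sum>i<Suc n. smult (c i) (u i)) = 0" using \<open>v n \<noteq> 0\<close> by simp
    moreover have "c n \<noteq> 0" by (simp add: c_def)
    ultimately show ?thesis by blast
  qed
qed

section \<open>Degrees in a minimal dependency between powers\<close>

lemma order_prod:
  fixes f :: "'b \<Rightarrow> complex poly"
  assumes "finite S" "\<And>i. i \<in> S \<Longrightarrow> f i \<noteq> 0"
  shows "order z (\<Prod>i\<in>S. f i) = (\<Sum>i\<in>S. order z (f i))"
  using assms by (induction S rule: finite_induct) (simp_all add: order_mult)

lemma order_power:
  fixes p :: "complex poly"
  shows "p \<noteq> 0 \<Longrightarrow> order z (p ^ m) = m * order z p"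
  by (induction m) (simp_all add: order_mult)

text \<open>
  Over the complex numbers the degree is the sum of the orders at all points.
\<close>

lemma order_le_imp_degree_le:
  fixes p q :: "complex poly"
  assumes "p \<noteq> 0" "q \<noteq> 0" "\<And>z. order z p \<le> order z q"
  shows "degree p \<le> degree q"
proof -
  have deg: "degree r = (\<Sum>z\<in>S. order z r)" if "r \<noteq> 0" "finite S" "{z. poly r z = 0} \<subseteq> S"
    for r :: "complex poly" and S
  proof -
    have "degree r = degree (smult (lead_coeff r) (\<Prod>z | poly r z = 0. [:-z, 1:] ^ order z r))"
      by (simp add: complex_poly_decompose)
    also have "\<dots> = (\<Sum>z | poly r z = 0. order z r)"
      using that(1) by (subst degree_smult_eq) (auto simp: degree_prod_eq_sum_degree degree_power_eq)
    also have "\<dots> = (\<Sum>z\<in>S. order z r)"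
      using that by (intro sum.mono_neutral_left) (auto simp: order_0I)
    finally show ?thesis .
  qed
  let ?S = "{z. poly p z = 0} \<union> {z. poly q z = 0}"
  have "finite ?S" using assms by (simp add: poly_roots_finite)
  then show ?thesis
    using deg[of p ?S] deg[of q ?S] assms by (auto intro!: sum_mono)
qed

text \<open>
  The first term bounds the degree of the Wronskian of the first \<open>n\<close> powers from below by its zeros;
  the exponents, less \<open>0 + \<dots> + (n - 1)\<close> for the derivatives, bound it from above.
  At every point, a member that does not vanish there is the one to leave out.
\<close>

lemma circuit_degree_inequality:
  fixes g :: "nat \<Rightarrow> complex poly" and c :: "nat \<Rightarrow> complex"
  assumes relation: "(\<Sum>i\<le>n. smult (c i) (g i ^ d)) = 0"
    and c: "\<And>i. i \<le> n \<Longrightarrow> c i \<noteq> 0"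
    and g: "\<And>i. i \<le> n \<Longrightarrow> g i \<noteq> 0"
    and independent: "\<And>b. (\<Sum>i<n. smult (b i) (g i ^ d)) = 0 \<Longrightarrow> \<forall>i<n. b i = 0"
    and no_common_root: "\<And>z. \<exists>i\<le>n. poly (g i) z \<noteq> 0"
  obtains e where "inj_on e {..<n}" "\<And>i. i < n \<Longrightarrow> e i \<le> d * degree (g i)"
    "(d + 1 - n) * (\<Sum>i\<le>n. degree (g i)) + (\<Sum>i<n. i) \<le> (\<Sum>i<n. e i)"
proof -
  define u where "u i = smult (c i) (g i ^ d)" for i
  let ?W = "wronskian n u"
  let ?P = "\<Prod>i\<le>n. g i"
  have "?W \<noteq> 0"
  proof
    assume "?W = 0"
    then obtain b i where "i < n" "b i \<noteq> 0" "(\<Sum>i<n. smult (b i) (u i)) = 0"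
      using wronskian_eq_0_imp_dependent by blast
    then show False
      using independent[of "\<lambda>i. b i * c i"] c[of i] by (auto simp: u_def)
  qed
  have "n > 0" using relation c[of 0] g[of 0] by (cases n) auto
  have P: "?P \<noteq> 0" using g by simp
  have local_order: "(d + 1 - n) * order z ?P \<le> order z ?W" for z
  proof -
    let ?q = "[:-z, 1:]"
    have order_P: "order z ?P = (\<Sum>i\<le>n. order z (g i))"
      using g by (intro order_prod) auto
    have dvd_u: "?q ^ (order z (g i) * d) dvd u i" for i
      unfolding u_def power_mult by (intro dvd_smult dvd_power_same order_1)
    \<comment> \<open>trivial for \<open>n > d\<close>, where truncated subtraction makes the left side zero\<close>
    have bound: "(d + 1 - n) * a \<le> a * d - (n - 1)" for a
    proof (cases "a = 0 \<or> d + 1 \<le> n")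
      case False
      then have "(d + 1 - n) * a + (n - 1) \<le> (d + 1 - n) * a + a * (n - 1)" by simp
      also have "\<dots> = a * d"
        using False \<open>n > 0\<close> by (cases n) (auto simp: algebra_simps simp flip: add_mult_distrib2)
      finally show ?thesis by linarith
    qed auto
    obtain k where k: "k \<le> n" "poly (g k) z \<noteq> 0" using no_common_root by blast
    then have ord_k: "order z (g k) = 0" by (simp add: order_0I)
    have "\<exists>u'. ?q ^ (\<Sum>i\<in>{..n} - {k}. order z (g i) * d - (n - 1)) dvd wronskian n u' \<and>
      (wronskian n u' = ?W \<or> wronskian n u' = - ?W)"
    proof (cases "k = n")
      case True
      then have "{..n} - {k} = {..<n}" by auto
      then show ?thesis using power_dvd_wronskian[of n ?q "\<lambda>i. order z (g i) * d" u] dvd_u by auto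
    next
      case False
      with k have "k < n" by simp
      let ?t = "\<lambda>i. if i = k then n else i"
      have "wronskian n (u(k := u n)) = - ?W"
        using relation \<open>k < n\<close> by (intro wronskian_replace) (simp_all add: u_def)
      moreover have "?q ^ (\<Sum>i<n. order z (g (?t i)) * d - (n - 1)) dvd wronskian n (u(k := u n))"
        by (rule power_dvd_wronskian) (simp add: dvd_u)
      moreover have "(\<Sum>i\<in>{..n} - {k}. order z (g i) * d - (n - 1))
          = (\<Sum>i<n. order z (g (?t i)) * d - (n - 1))"
        by (rule sum.reindex_bij_witness[of _ ?t "\<lambda>i. if i = n then k else i"])
          (use \<open>k < n\<close> in \<open>auto split: if_splits\<close>)
      ultimately show ?thesis by auto
    qed
    then have "?q ^ (\<Sum>i\<in>{..n} - {k}. order z (g i) * d - (n - 1)) dvd ?W" by auto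
    then have "(\<Sum>i\<in>{..n} - {k}. order z (g i) * d - (n - 1)) \<le> order z ?W"
      using \<open>?W \<noteq> 0\<close> order_divides by blast
    moreover have "(d + 1 - n) * order z ?P = (\<Sum>i\<in>{..n} - {k}. (d + 1 - n) * order z (g i))"
      using k(1) ord_k unfolding order_P sum_distrib_left
      by (subst sum.remove[of _ k]) auto
    moreover have "\<dots> \<le> (\<Sum>i\<in>{..n} - {k}. order z (g i) * d - (n - 1))"
      by (intro sum_mono bound)
    ultimately show ?thesis by linarith
  qed
  have "degree (?P ^ (d + 1 - n)) \<le> degree ?W"
    using P \<open>?W \<noteq> 0\<close> local_order by (intro order_le_imp_degree_le) (auto simp: order_power)
  then have deg_W: "(d + 1 - n) * (\<Sum>i\<le>n. degree (g i)) \<le> degree ?W"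
    using P g by (simp add: degree_power_eq degree_prod_eq_sum_degree)
  obtain e where e: "inj_on e {..<n}" "\<And>i. i < n \<Longrightarrow> e i \<le> degree (u i)"
      "degree ?W + (\<Sum>i<n. i) \<le> (\<Sum>i<n. e i)"
    using wronskian_distinct_exponents[OF \<open>?W \<noteq> 0\<close>] by blast
  show thesis
  proof (rule that)
    show "e i \<le> d * degree (g i)" if "i < n" for i
      using e(2)[OF that] c[of i] g[of i] that by (simp add: u_def degree_power_eq)
  qed (use e deg_W in auto)
qed

text \<open>
  The dehomogenized counterpart of a dependent set of \<open>d\<close>-th powers. Indexing the
  coefficients by the polynomials, not by their powers, lets a relation be restricted to a subset or
  divided by a common factor one polynomial at a time.
\<close>

definition dependent_powers :: "nat \<Rightarrow> complex poly set \<Rightarrow> bool" where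
  "dependent_powers d G \<longleftrightarrow> finite G \<and> 0 \<notin> G \<and> (\<forall>f\<in>G. \<forall>g\<in>G. f \<noteq> g \<longrightarrow> (\<forall>c. f \<noteq> smult c g)) \<and>
    (\<exists>c. (\<exists>g\<in>G. c g \<noteq> 0) \<and> (\<Sum>g\<in>G. smult (c g) (g ^ d)) = 0)"

text \<open>
  By unique factorization, \<open>f\<close> and \<open>g\<close> divide each other once their powers do.
\<close>

lemma proportional_powers_imp_proportional:
  fixes f g :: "complex poly"
  assumes eq: "f ^ d = smult a (g ^ d)" and "f \<noteq> 0" "d \<ge> 1"
  shows "\<exists>c. f = smult c g"
proof -
  have "a \<noteq> 0" "g \<noteq> 0" using eq assms(2,3) by (auto simp: power_0_left)
  then have "f ^ d dvd g ^ d" "g ^ d dvd f ^ d"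
    unfolding eq by (simp_all add: smult_dvd_iff dvd_smult)
  then have "f dvd g" "g dvd f" using \<open>d \<ge> 1\<close> by (simp_all add: pow_divides_pow_iff)
  then obtain h where h: "f = g * h" by (elim dvdE)
  have "degree f \<le> degree g" using \<open>f dvd g\<close> \<open>g \<noteq> 0\<close> by (rule dvd_imp_degree_le)
  then have "degree h = 0" using h \<open>f \<noteq> 0\<close> by (auto simp: degree_mult_eq)
  then obtain c where "h = [:c:]" by (rule degree_eq_zeroE)
  with h show ?thesis by auto
qed

text \<open>
  Any common divisor of largest degree will do for \<open>h\<close>: a common zero of the quotients would enlarge it.
\<close>

lemma common_factor:
  fixes S :: "complex poly set"
  assumes "S \<noteq> {}" "0 \<notin> S"
  obtains h q where "h \<noteq> 0" "\<And>f. f \<in> S \<Longrightarrow> f = h * q f" "\<And>z. \<exists>f\<in>S. poly (q f) z \<noteq> 0"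
proof -
  obtain f0 where f0: "f0 \<in> S" using assms by blast
  let ?P = "\<lambda>h. \<forall>f\<in>S. h dvd f"
  have bound: "degree h < Suc (degree f0)" if "?P h" for h
  proof -
    have "f0 \<noteq> 0" "h dvd f0" using f0 assms(2) that by auto
    then show ?thesis using dvd_imp_degree_le[of h f0] by simp
  qed
  obtain h where h: "?P h" "\<And>h'. ?P h' \<Longrightarrow> degree h' \<le> degree h"
    using ex_has_greatest_nat[of ?P 1 degree "Suc (degree f0)"] bound by (auto simp: less_imp_le)
  have "h \<noteq> 0" using h(1) f0 assms(2) by auto
  have fq: "f = h * (f div h)" if "f \<in> S" for f using h(1) that by auto
  show thesis
  proof (rule that)
    show "\<exists>f\<in>S. poly (f div h) z \<noteq> 0" for z
    proof (rule ccontr)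
      assume "\<not> (\<exists>f\<in>S. poly (f div h) z \<noteq> 0)"
      then have "[:-z, 1:] dvd f div h" if "f \<in> S" for f using that by (simp add: poly_eq_0_iff_dvd)
      then have "?P (h * [:-z, 1:])" by (metis fq mult_dvd_mono dvd_refl)
      then have "degree (h * [:-z, 1:]) \<le> degree h" by (rule h(2))
      moreover have "degree (h * [:-z, 1:]) = degree h + 1"
        using \<open>h \<noteq> 0\<close> by (subst degree_mult_eq) auto
      ultimately show False by linarith
    qed
  qed (use \<open>h \<noteq> 0\<close> fq in auto)
qed

text \<open>
  Pass to a dependent subset of least size \<open>n + 1\<close>, divide by the common factor and number the
  members so that the last has the largest degree; \<open>D i\<close> are the resulting degrees. The last one is
  not seen by the exponents \<open>e\<close>, so making it the largest is the best choice. A relation with one or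
  two terms would make a member zero or two members proportional, so \<open>n \<ge> 2\<close>.
\<close>

lemma dependent_powers_degree_inequality:
  assumes G: "dependent_powers d G" and "d \<ge> 1" and deg_G: "\<And>g. g \<in> G \<Longrightarrow> degree g \<le> k"
  shows "\<exists>n D e. 2 \<le> n \<and> n < card G \<and> (\<forall>i\<le>n. D i \<le> k) \<and> (\<forall>i<n. D i \<le> D n) \<and>
    inj_on e {..<n} \<and> (\<forall>i<n. e i \<le> d * D i) \<and>
    (d + 1 - n) * (\<Sum>i\<le>n. D i) + (\<Sum>i<n. i) \<le> (\<Sum>i<n. e i)"
proof -
  have finG: "finite G" and G0: "0 \<notin> G" and nonprop: "\<And>f g c. f \<in> G \<Longrightarrow> g \<in> G \<Longrightarrow> f \<noteq> g \<Longrightarrow> f \<noteq> smult c g"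
    using G by (auto simp: dependent_powers_def)
  let ?Dep = "\<lambda>S. S \<subseteq> G \<and> (\<exists>c. (\<exists>g\<in>S. c g \<noteq> 0) \<and> (\<Sum>g\<in>S. smult (c g) (g ^ d)) = 0)"
  have "?Dep G" using G unfolding dependent_powers_def by blast
  then obtain S where S: "?Dep S" "\<And>T. ?Dep T \<Longrightarrow> card S \<le> card T"
    using ex_has_least_nat[of ?Dep G card] by blast
  then obtain c where c: "\<exists>g\<in>S. c g \<noteq> 0" "(\<Sum>g\<in>S. smult (c g) (g ^ d)) = 0" by blast
  have "S \<subseteq> G" using S(1) by blast
  then have finS: "finite S" using finG by (rule finite_subset)
  have "S \<noteq> {}" using c by auto
  have S0: "0 \<notin> S" using \<open>S \<subseteq> G\<close> G0 by blast
  \<comment> \<open>a zero coefficient would allow a smaller dependent subset\<close>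
  have c_nz: "c g \<noteq> 0" if "g \<in> S" for g
  proof
    assume "c g = 0"
    then have "(\<Sum>f\<in>S - {g}. smult (c f) (f ^ d)) = 0"
      using c(2) finS that by (simp add: sum_diff1)
    moreover have "\<exists>f\<in>S - {g}. c f \<noteq> 0" using c(1) \<open>c g = 0\<close> by auto
    ultimately have "?Dep (S - {g})" using \<open>S \<subseteq> G\<close> by blast
    then have "card S \<le> card (S - {g})" by (rule S(2))
    then show False using card_Diff1_less[OF finS that] by linarith
  qed
  obtain h q where h: "h \<noteq> 0" "\<And>f. f \<in> S \<Longrightarrow> f = h * q f" "\<And>z. \<exists>f\<in>S. poly (q f) z \<noteq> 0"
    using common_factor[OF \<open>S \<noteq> {}\<close> S0] by blast
  have q0: "q f \<noteq> 0" if "f \<in> S" for f using h(2)[OF that] S0 that by auto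
  obtain g0 where g0: "g0 \<in> S" "\<And>f. f \<in> S \<Longrightarrow> degree (q f) \<le> degree (q g0)"
  proof -
    have "Max ((\<lambda>f. degree (q f)) ` S) \<in> (\<lambda>f. degree (q f)) ` S"
      using finS \<open>S \<noteq> {}\<close> by (intro Max_in) auto
    then obtain g where g: "g \<in> S" "Max ((\<lambda>f. degree (q f)) ` S) = degree (q g)" by auto
    have "degree (q f) \<le> degree (q g)" if "f \<in> S" for f
      unfolding g(2)[symmetric] using finS that by (intro Max_ge) auto
    from that[OF g(1) this] show ?thesis .
  qed
  define n where "n = card (S - {g0})"
  have cardS: "card S = Suc n" unfolding n_def using card.remove[OF finS g0(1)] .
  obtain b where b: "bij_betw b {..<n} (S - {g0})"
    using ex_bij_betw_nat_finite[of "S - {g0}"] finS by (auto simp: n_def atLeast0LessThan)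
  define F where "F = b(n := g0)"
  have "bij_betw F {..<n} (S - {g0})"
    using b by (subst bij_betw_cong[of _ _ b]) (auto simp: F_def)
  then have F_less: "inj_on F {..<n}" "F ` {..<n} = S - {g0}" by (auto simp: bij_betw_def)
  have "bij_betw F (insert n {..<n}) (insert g0 (S - {g0}))"
    using F_less by (auto simp: bij_betw_def F_def)
  then have F: "bij_betw F {..n} S" using g0(1) by (simp add: insert_absorb lessThan_Suc_atMost[symmetric] lessThan_Suc)
  then have F_in: "F i \<in> S" if "i \<le> n" for i using that by (auto simp: bij_betw_def)
  have relation: "(\<Sum>i\<le>n. smult (c (F i)) (F i ^ d)) = 0"
    using c(2) sum.reindex_bij_betw[OF F, of "\<lambda>g. smult (c g) (g ^ d)"] by simp
  have power_F: "F i ^ d = h ^ d * q (F i) ^ d" if "i \<le> n" for i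
    using h(2)[OF F_in[OF that]] by (metis power_mult_distrib)
  have "n \<ge> 2"
  proof (rule ccontr)
    assume "\<not> 2 \<le> n"
    then consider "n = 0" | "n = 1" by linarith
    then show False
    proof cases
      case 1
      then show False using relation c_nz[OF F_in[of 0]] F_in[of 0] S0 by auto
    next
      case 2
      then have "smult (c (F 0)) (F 0 ^ d) = - smult (c (F 1)) (F 1 ^ d)"
        using relation by (simp add: eq_neg_iff_add_eq_0)
      then have "smult (inverse (c (F 0))) (smult (c (F 0)) (F 0 ^ d))
          = smult (inverse (c (F 0))) (- smult (c (F 1)) (F 1 ^ d))"
        by (rule arg_cong)
      then have "F 0 ^ d = smult (- (inverse (c (F 0)) * c (F 1))) (F 1 ^ d)"
        using c_nz[OF F_in[of 0]] by simp
      moreover have "F 0 \<noteq> 0" using F_in[of 0] S0 by auto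
      ultimately obtain a where a: "F 0 = smult a (F 1)"
        using proportional_powers_imp_proportional \<open>d \<ge> 1\<close> by blast
      moreover have "F 0 \<noteq> F 1"
        using F 2 by (auto simp: bij_betw_def inj_on_def)
      ultimately show False
        using nonprop[of "F 0" "F 1" a] F_in[of 0] F_in[of 1] 2 \<open>S \<subseteq> G\<close> by auto
    qed
  qed
  have "h ^ d \<noteq> 0" using h(1) by simp
  obtain e where e: "inj_on e {..<n}" "\<And>i. i < n \<Longrightarrow> e i \<le> d * degree (q (F i))"
      "(d + 1 - n) * (\<Sum>i\<le>n. degree (q (F i))) + (\<Sum>i<n. i) \<le> (\<Sum>i<n. e i)"
  proof (rule circuit_degree_inequality[where n = n and c = "\<lambda>i. c (F i)" and g = "\<lambda>i. q (F i)" and d = d])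
    have "h ^ d * (\<Sum>i\<le>n. smult (c (F i)) (q (F i) ^ d)) = 0"
      unfolding relation[symmetric] sum_distrib_left by (intro sum.cong) (auto simp: power_F)
    then show "(\<Sum>i\<le>n. smult (c (F i)) (q (F i) ^ d)) = 0" using \<open>h ^ d \<noteq> 0\<close> by auto
    show "\<forall>i<n. a i = 0" if a: "(\<Sum>i<n. smult (a i) (q (F i) ^ d)) = 0" for a
    proof (rule ccontr)
      assume "\<not> (\<forall>i<n. a i = 0)"
      then obtain i where i: "i < n" "a i \<noteq> 0" by blast
      define a' where "a' f = a (the_inv_into {..<n} F f)" for f
      have a': "a' (F i) = a i" if "i < n" for i
        using that F_less(1) by (simp add: a'_def the_inv_into_f_f)
      have "(\<Sum>f\<in>S - {g0}. smult (a' f) (f ^ d)) = (\<Sum>i<n. smult (a i) (F i ^ d))"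
        unfolding F_less(2)[symmetric] by (simp add: sum.reindex[OF F_less(1)] a')
      also have "\<dots> = h ^ d * (\<Sum>i<n. smult (a i) (q (F i) ^ d))"
        unfolding sum_distrib_left by (intro sum.cong) (auto simp: power_F)
      finally have "(\<Sum>f\<in>S - {g0}. smult (a' f) (f ^ d)) = 0" by (simp add: a)
      moreover have "F i \<in> S - {g0}" "a' (F i) \<noteq> 0" using i a' F_less(2) by auto
      ultimately have "?Dep (S - {g0})" using \<open>S \<subseteq> G\<close> by blast
      then have "card S \<le> n" unfolding n_def by (rule S(2))
      then show False by (simp add: cardS)
    qed
    show "\<exists>i\<le>n. poly (q (F i)) z \<noteq> 0" for z
    proof -
      obtain f where "f \<in> S" "poly (q f) z \<noteq> 0" using h(3) by blast
      moreover obtain i where "i \<le> n" "F i = f"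
        using F \<open>f \<in> S\<close> by (auto simp: bij_betw_def)
      ultimately show ?thesis by blast
    qed
  qed (use c_nz F_in q0 in auto)
  show ?thesis
  proof (rule exI[of _ n], rule exI[of _ "\<lambda>i. degree (q (F i))"], rule exI[of _ e],
      intro conjI allI impI)
    show "n < card G" using card_mono[OF finG \<open>S \<subseteq> G\<close>] cardS by simp
    show "degree (q (F i)) \<le> k" if "i \<le> n" for i
    proof -
      have "degree (q (F i)) \<le> degree (F i)"
        using h(2)[OF F_in[OF that]] F_in[OF that] S0 by (intro dvd_imp_degree_le) (metis dvd_triv_right, auto)
      also have "\<dots> \<le> k" using F_in[OF that] \<open>S \<subseteq> G\<close> deg_G by blast
      finally show ?thesis .
    qed
    show "degree (q (F i)) \<le> degree (q (F n))" if "i < n" for i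
      using g0(2) F_in[of i] that by (simp add: F_def)
  qed (use e \<open>n \<ge> 2\<close> in auto)
qed

text \<open>
  Let \<open>n \<le> d\<close>. With \<open>S = D 0 + \<dots> + D (n - 1) \<le> n * D n\<close>, the degree inequality gives \<open>(d + 1 - n) * (S + D n) < d * S\<close>,
  that is \<open>(d + 1 - n) * D n < (n - 1) * S \<le> (n - 1) * n * D n\<close>. Cancelling \<open>D n\<close> leaves
  \<open>d + 1 < n + (n - 1) * n = n ^ 2\<close>.
\<close>

lemma dependent_powers_card_gt:
  assumes "dependent_powers d G" "d \<ge> 1"
  shows "\<exists>n. 2 \<le> n \<and> n < card G \<and> d + 1 < n ^ 2"
proof -
  have fin: "finite G" using assms by (simp add: dependent_powers_def)
  obtain n D e where n: "2 \<le> n" "n < card G" and D: "\<forall>i<n. D i \<le> D n"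
    and e: "\<forall>i<n. e i \<le> d * D i" "(d + 1 - n) * (\<Sum>i\<le>n. D i) + (\<Sum>i<n. i) \<le> (\<Sum>i<n. e i)"
    using dependent_powers_degree_inequality[OF assms, of "Max (degree ` G)"] fin by auto
  define S where "S = (\<Sum>i<n. D i)"
  have "(\<Sum>i<n. e i) \<le> d * S"
    unfolding S_def sum_distrib_left using e(1) by (intro sum_mono) auto
  moreover have "(\<Sum>i\<le>n. D i) = S + D n" unfolding S_def by (simp add: lessThan_Suc_atMost[symmetric])
  moreover have "(\<Sum>i<n. i) \<ge> 1" using n(1) member_le_sum[of 1 "{..<n}" "\<lambda>i. i"] by simp
  ultimately have ineq: "(d + 1 - n) * (S + D n) + 1 \<le> d * S" using e(2) by simp
  have "S \<le> n * D n" unfolding S_def using sum_bounded_above[of "{..<n}" D "D n"] D by simp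
  have "d + 1 < n ^ 2"
  proof (cases "d + 1 \<le> n")
    case True
    also have "n < n ^ 2" using n(1) by (simp add: power2_eq_square)
    finally show ?thesis .
  next
    case False
    define m where "m = d + 1 - n"
    have d: "d = m + (n - 1)" using False n(1) by (simp add: m_def)
    have "m * D n + 1 \<le> (n - 1) * S"
      using ineq unfolding m_def[symmetric] unfolding d by (simp add: algebra_simps)
    also have "\<dots> \<le> (n - 1) * (n * D n)" using \<open>S \<le> n * D n\<close> by simp
    finally have "m * D n < ((n - 1) * n) * D n" unfolding mult.assoc by linarith
    then have "m < (n - 1) * n" unfolding mult_less_cancel2 by blast
    then have "d + 1 < (n - 1) * n + n" using d n(1) by simp
    also have "\<dots> = n ^ 2" using n(1) by (cases n) (simp_all add: power2_eq_square)
    finally show ?thesis .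
  qed
  with n show ?thesis by blast
qed

text \<open>
  The degree count leaves only \<open>n = 3\<close>, \<open>d = 6\<close> and all four degrees equal to \<open>2\<close>. Then the
  Wronskian must have degree at least \<open>4 * 8 = 32\<close>, while three distinct exponents up to \<open>12\<close> give at
  most \<open>12 + 11 + 10 - 3 = 30\<close>.
\<close>

lemma quadratic_dependent_powers_card_ge_5:
  assumes "dependent_powers d G" "d \<ge> 6" "\<And>g. g \<in> G \<Longrightarrow> degree g \<le> 2"
  shows "card G \<ge> 5"
proof (rule ccontr)
  assume "\<not> card G \<ge> 5"
  have "d \<ge> 1" using assms(2) by simp
  obtain n D e where n: "2 \<le> n" "n < card G" and D2: "\<forall>i\<le>n. D i \<le> 2"
    and e: "inj_on e {..<n}" "\<forall>i<n. e i \<le> d * D i"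
      "(d + 1 - n) * (\<Sum>i\<le>n. D i) + (\<Sum>i<n. i) \<le> (\<Sum>i<n. e i)"
    and D: "\<forall>i<n. D i \<le> D n"
    using dependent_powers_degree_inequality[OF assms(1) \<open>d \<ge> 1\<close> assms(3)] by blast
  have sum_less_2: "(\<Sum>i<2. f i) = f 0 + f 1" and sum_le_2: "(\<Sum>i\<le>2. f i) = f 0 + f 1 + f 2"
    and sum_less_3: "(\<Sum>i<3. f i) = f 0 + f 1 + f 2"
    and sum_le_3: "(\<Sum>i\<le>3. f i) = f 0 + f 1 + f 2 + f 3" for f :: "nat \<Rightarrow> nat"
    by (simp_all add: eval_nat_numeral)
  have "n = 2 \<or> n = 3" using n \<open>\<not> card G \<ge> 5\<close> by linarith
  then show False
  proof
    assume [simp]: "n = 2"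
    have D3: "D 0 \<le> D 2" "D 1 \<le> D 2" using D by auto
    obtain b where b: "d = b + 6" using assms(2) by (metis add.commute le_Suc_ex)
    have e_le: "e 0 \<le> d * D 0" "e 1 \<le> d * D 1" using e(2) by simp_all
    have "(d - 1) * (D 0 + D 1 + D 2) + 1 \<le> e 0 + e 1"
      using e(3) by (simp add: sum_less_2 sum_le_2)
    then have "b * D 2 + 5 * D 2 + 1 \<le> D 0 + D 1"
      using e_le unfolding b by (simp add: algebra_simps)
    moreover define x where "x = b * D 2"
    ultimately show False using D3 by linarith
  next
    assume [simp]: "n = 3"
    have D3: "D 0 \<le> D 3" "D 1 \<le> D 3" "D 2 \<le> D 3" "D 3 \<le> 2" using D D2 by auto
    have e_le: "e 0 \<le> d * D 0" "e 1 \<le> d * D 1" "e 2 \<le> d * D 2" using e(2) by simp_all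
    have ineq: "(d - 2) * (D 0 + D 1 + D 2 + D 3) + 3 \<le> e 0 + e 1 + e 2"
      using e(3) by (simp add: sum_less_3 sum_le_3)
    obtain b where b: "d = b + 6" using assms(2) by (metis add.commute le_Suc_ex)
    have ineq2: "b * D 3 + 4 * D 3 + 3 \<le> 2 * (D 0 + D 1 + D 2)"
      using ineq e_le unfolding b by (simp add: algebra_simps)
    have "4 * D 3 + 3 \<le> 2 * (D 0 + D 1 + D 2)"
      using ineq2 by (rule order_trans[rotated]) simp
    then have "2 \<le> D 3" "2 \<le> D 0" "2 \<le> D 1" "2 \<le> D 2" using D3 by simp_all
    then have D_eq: "D 0 = 2" "D 1 = 2" "D 2 = 2" "D 3 = 2" using D3 by simp_all
    with ineq2 have "b = 0" by simp
    with b have "d = 6" by simp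
    moreover have "e 0 \<noteq> e 1" "e 0 \<noteq> e 2" "e 1 \<noteq> e 2"
      by (simp_all add: inj_on_eq_iff[OF e(1)])
    ultimately show False using ineq e_le unfolding D_eq by simp
  qed
qed

section \<open>Dehomogenization\<close>

definition homogenize :: "nat \<Rightarrow> complex poly \<Rightarrow> complex poly poly" where
  "homogenize k p = (\<Sum>i\<le>k. monom (monom (coeff p i) i) (k - i))"

lemma coeff_homogenize:
  "coeff (coeff (homogenize k p) j) i = (if i + j = k then coeff p i else 0)"
proof -
  have "coeff (coeff (homogenize k p) j) i
      = (\<Sum>l\<le>k. if i = l then (if i + j = k then coeff p i else 0) else 0)"
    unfolding homogenize_def coeff_sum by (rule sum.cong) auto
  then show ?thesis by simp
qed

lemma coeff_dehomogenize:
  assumes "f \<in> binary_forms k"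
  shows "coeff (poly f 1) i = (if i \<le> k then coeff (coeff f (k - i)) i else 0)"
proof -
  have f: "coeff (coeff f j) i = 0" if "i + j \<noteq> k" for j
    using assms that by (auto simp: binary_forms_def)
  have "coeff (poly f 1) i = (\<Sum>j\<le>degree f. coeff (coeff f j) i)"
    by (simp add: poly_altdef coeff_sum)
  also have "\<dots> = (\<Sum>j\<le>degree f. if k - i = j then (if i \<le> k then coeff (coeff f (k - i)) i else 0) else 0)"
    by (rule sum.cong) (auto intro: f)
  also have "\<dots> = (if i \<le> k then coeff (coeff f (k - i)) i else 0)"
    by (auto simp: coeff_eq_0)
  finally show ?thesis .
qed

lemma degree_dehomogenize: "f \<in> binary_forms k \<Longrightarrow> degree (poly f 1) \<le> k"
  by (intro degree_le) (simp add: coeff_dehomogenize)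

lemma dehomogenize_inject:
  assumes "f \<in> binary_forms k" "g \<in> binary_forms k" "poly f 1 = poly g 1"
  shows "f = g"
proof (intro poly_eqI)
  fix i j
  show "coeff (coeff f j) i = coeff (coeff g j) i"
  proof (cases "i + j = k")
    case True
    then have "i \<le> k" "k - i = j" by auto
    then show ?thesis
      using arg_cong[OF assms(3), of "\<lambda>p. coeff p i"] coeff_dehomogenize[OF assms(1), of i]
        coeff_dehomogenize[OF assms(2), of i] by simp
  next
    case False
    then show ?thesis using assms(1,2) by (force simp: binary_forms_def)
  qed
qed

lemma homogenize_in_binary_forms: "homogenize k p \<in> binary_forms k"
  by (auto simp: binary_forms_def coeff_homogenize)

lemma dehomogenize_homogenize: "degree p \<le> k \<Longrightarrow> poly (homogenize k p) 1 = p"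
  by (rule poly_eqI)
    (auto simp: coeff_dehomogenize[OF homogenize_in_binary_forms] coeff_homogenize coeff_eq_0)

lemma zero_in_binary_forms: "0 \<in> binary_forms k"
  by (simp add: binary_forms_def)

lemma add_in_binary_forms: "f \<in> binary_forms k \<Longrightarrow> g \<in> binary_forms k \<Longrightarrow> f + g \<in> binary_forms k"
  unfolding binary_forms_def mem_Collect_eq coeff_add by (metis add.right_neutral)

lemma sum_in_binary_forms: "(\<And>x. x \<in> S \<Longrightarrow> f x \<in> binary_forms k) \<Longrightarrow> (\<Sum>x\<in>S. f x) \<in> binary_forms k"
  by (induction S rule: infinite_finite_induct) (auto simp: zero_in_binary_forms add_in_binary_forms)

lemma bscale_in_binary_forms: "f \<in> binary_forms k \<Longrightarrow> bscale c f \<in> binary_forms k"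
  by (auto simp: binary_forms_def bscale_def)

lemma mult_in_binary_forms:
  assumes "f \<in> binary_forms k" "g \<in> binary_forms l"
  shows "f * g \<in> binary_forms (k + l)"
  unfolding binary_forms_def mem_Collect_eq
proof (intro allI impI)
  fix i j
  assume "coeff (coeff (f * g) j) i \<noteq> 0"
  then have "(\<Sum>b\<le>j. \<Sum>a\<le>i. coeff (coeff f b) a * coeff (coeff g (j - b)) (i - a)) \<noteq> 0"
    by (simp add: coeff_mult coeff_sum)
  then obtain a b where "a \<le> i" "b \<le> j" "coeff (coeff f b) a * coeff (coeff g (j - b)) (i - a) \<noteq> 0"
    by (metis (mono_tags, lifting) atMost_iff sum.not_neutral_contains_not_neutral)
  moreover from this have "a + b = k" "(i - a) + (j - b) = l"
    using assms by (auto simp: binary_forms_def)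
  ultimately show "i + j = k + l" by linarith
qed

lemma power_in_binary_forms: "f \<in> binary_forms k \<Longrightarrow> f ^ d \<in> binary_forms (d * k)"
proof (induction d)
  case 0
  have "coeff (coeff 1 j) i = 0" if "i + j \<noteq> 0" for i j
    using that by (cases j; cases i) (auto simp: coeff_1)
  then show ?case unfolding binary_forms_def by auto
next
  case (Suc d)
  then show ?case using mult_in_binary_forms[of f k "f ^ d" "d * k"] by simp
qed

lemma dehomogenize_bscale: "poly (bscale c f) 1 = smult c (poly f 1)"
  by (simp add: bscale_def)

lemma dehomogenize_eq_0_iff: "f \<in> binary_forms k \<Longrightarrow> poly f 1 = 0 \<longleftrightarrow> f = 0"
  using dehomogenize_inject[of f k 0] zero_in_binary_forms by auto

text \<open>
  Setting \<open>y = 1\<close> is a ring homomorphism that is injective on the forms of each degree, in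
  particular on those of degree \<open>d * k\<close>, where the relation between the powers lives. Passing between
  coefficients indexed by powers and by forms needs that \<open>f \<mapsto> f ^ d\<close> is injective on an honest set.
\<close>

lemma W_set_iff_dependent_powers:
  assumes F: "F \<subseteq> binary_forms k" and "d \<ge> 1"
  shows "W_set k r d F \<longleftrightarrow> dependent_powers d ((\<lambda>f. poly f 1) ` F) \<and> card F = r"
proof -
  let ?h = "\<lambda>f :: complex poly poly. poly f 1"
  have inj: "inj_on ?h F"
    using F dehomogenize_inject by (intro inj_onI) blast
  have fin: "finite (?h ` F) \<longleftrightarrow> finite F" using inj by (rule finite_image_iff)
  have zero: "0 \<in> ?h ` F \<longleftrightarrow> 0 \<in> F"
    using F dehomogenize_eq_0_iff by (force simp: image_iff)
  have proportional_iff: "proportional f g \<longleftrightarrow> (\<exists>c. ?h f = smult c (?h g))"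
    if "f \<in> F" "g \<in> F" "0 \<notin> F" for f g
  proof
    assume "\<exists>c. ?h f = smult c (?h g)"
    then obtain c where c: "?h f = ?h (bscale c g)" by (auto simp: dehomogenize_bscale)
    then have eq: "f = bscale c g"
      using that F by (intro dehomogenize_inject[of f k]) (auto intro: bscale_in_binary_forms)
    then have "c \<noteq> 0" using that by (auto simp: bscale_def)
    with eq show "proportional f g" by (auto simp: proportional_def)
  qed (auto simp: proportional_def dehomogenize_bscale)
  have honest_iff: "honest k F \<longleftrightarrow> finite (?h ` F) \<and> 0 \<notin> ?h ` F \<and>
      (\<forall>f\<in>?h ` F. \<forall>g\<in>?h ` F. f \<noteq> g \<longrightarrow> (\<forall>c. f \<noteq> smult c g))"
  proof -
    have "(\<forall>f\<in>?h ` F. \<forall>g\<in>?h ` F. f \<noteq> g \<longrightarrow> (\<forall>c. f \<noteq> smult c g)) \<longleftrightarrow>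
        (\<forall>f\<in>F. \<forall>g\<in>F. f \<noteq> g \<longrightarrow> \<not> proportional f g)" if "0 \<notin> F"
      by (simp add: proportional_iff[OF _ _ that] inj_on_eq_iff[OF inj] cong: ball_cong)
    then show ?thesis
      using F unfolding honest_def fin zero pairwise_def by blast
  qed
  have dependent_iff: "bpoly.dependent ((\<lambda>f. f ^ d) ` F) \<longleftrightarrow>
      (\<exists>c. (\<exists>g\<in>?h ` F. c g \<noteq> 0) \<and> (\<Sum>g\<in>?h ` F. smult (c g) (g ^ d)) = 0)"
    if "honest k F"
  proof -
    have finF: "finite F" and F0: "0 \<notin> F" using that by (auto simp: honest_def)
    have inj_power: "inj_on (\<lambda>f. f ^ d) F"
    proof (rule inj_onI, rule ccontr)
      fix f g assume fg: "f \<in> F" "g \<in> F" "f ^ d = g ^ d" "f \<noteq> g"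
      then have "?h f ^ d = smult 1 (?h g ^ d)" by (metis poly_power smult_1_left)
      moreover have "?h f \<noteq> 0" using zero F0 fg(1) by (metis imageI)
      ultimately have "proportional f g"
        using proportional_powers_imp_proportional \<open>d \<ge> 1\<close> proportional_iff fg F0 by blast
      then show False using that fg by (auto simp: honest_def pairwise_def)
    qed
    have vanish: "(\<Sum>f\<in>F. bscale (u f) (f ^ d)) = 0 \<longleftrightarrow> (\<Sum>f\<in>F. smult (u f) (?h f ^ d)) = 0" for u
    proof -
      have "(\<Sum>f\<in>F. bscale (u f) (f ^ d)) \<in> binary_forms (d * k)"
        using F by (intro sum_in_binary_forms bscale_in_binary_forms power_in_binary_forms) auto
      from dehomogenize_eq_0_iff[OF this] show ?thesis
        by (simp add: poly_sum dehomogenize_bscale poly_power)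
    qed
    have "bpoly.dependent ((\<lambda>f. f ^ d) ` F) \<longleftrightarrow>
        (\<exists>u. (\<exists>f\<in>F. u (f ^ d) \<noteq> 0) \<and> (\<Sum>f\<in>F. bscale (u (f ^ d)) (f ^ d)) = 0)"
      using finF by (simp add: bpoly.dependent_finite sum.reindex[OF inj_power])
    also have "\<dots> \<longleftrightarrow> (\<exists>u. (\<exists>f\<in>F. u f \<noteq> 0) \<and> (\<Sum>f\<in>F. bscale (u f) (f ^ d)) = 0)"
      (is "?l \<longleftrightarrow> ?r")
    proof
      assume ?r
      then obtain u where u: "\<exists>f\<in>F. u f \<noteq> 0" "(\<Sum>f\<in>F. bscale (u f) (f ^ d)) = 0" by blast
      define v where "v p = u (the_inv_into F (\<lambda>f. f ^ d) p)" for p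
      have "v (f ^ d) = u f" if "f \<in> F" for f
        using the_inv_into_f_f[OF inj_power that] by (simp add: v_def)
      then have "(\<exists>f\<in>F. v (f ^ d) \<noteq> 0) \<and> (\<Sum>f\<in>F. bscale (v (f ^ d)) (f ^ d)) = 0"
        using u by simp
      then show ?l by blast
    next
      assume ?l
      then obtain u where "(\<exists>f\<in>F. u (f ^ d) \<noteq> 0) \<and> (\<Sum>f\<in>F. bscale (u (f ^ d)) (f ^ d)) = 0" ..
      then show ?r by (rule exI[of _ "\<lambda>f. u (f ^ d)"])
    qed
    also have "\<dots> \<longleftrightarrow> (\<exists>u. (\<exists>f\<in>F. u f \<noteq> 0) \<and> (\<Sum>f\<in>F. smult (u f) (?h f ^ d)) = 0)"
      unfolding vanish ..
    also have "\<dots> \<longleftrightarrow> (\<exists>c. (\<exists>f\<in>F. c (?h f) \<noteq> 0) \<and> (\<Sum>f\<in>F. smult (c (?h f)) (?h f ^ d)) = 0)"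
      (is "?l \<longleftrightarrow> ?r")
    proof
      assume ?l
      then obtain u where u: "\<exists>f\<in>F. u f \<noteq> 0" "(\<Sum>f\<in>F. smult (u f) (?h f ^ d)) = 0" by blast
      define v where "v p = u (the_inv_into F ?h p)" for p
      have "v (?h f) = u f" if "f \<in> F" for f
        using the_inv_into_f_f[OF inj that] by (simp add: v_def)
      then have "(\<exists>f\<in>F. v (?h f) \<noteq> 0) \<and> (\<Sum>f\<in>F. smult (v (?h f)) (?h f ^ d)) = 0"
        using u by simp
      then show ?r by blast
    next
      assume ?r
      then obtain c where "(\<exists>f\<in>F. c (?h f) \<noteq> 0) \<and> (\<Sum>f\<in>F. smult (c (?h f)) (?h f ^ d)) = 0" ..
      then show ?l by (rule exI[of _ "\<lambda>f. c (?h f)"])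
    qed
    also have "\<dots> \<longleftrightarrow> (\<exists>c. (\<exists>g\<in>?h ` F. c g \<noteq> 0) \<and> (\<Sum>g\<in>?h ` F. smult (c g) (g ^ d)) = 0)"
      by (simp add: sum.reindex[OF inj])
    finally show ?thesis .
  qed
  show ?thesis
    unfolding W_set_def dependent_powers_def using honest_iff dependent_iff by blast
qed

lemma ex_W_set_iff:
  assumes "d \<ge> 1"
  shows "(\<exists>F. W_set k r d F) \<longleftrightarrow> (\<exists>G. dependent_powers d G \<and> (\<forall>g\<in>G. degree g \<le> k) \<and> card G = r)"
proof
  assume "\<exists>F. W_set k r d F"
  then obtain F where W: "W_set k r d F" ..
  then have F: "F \<subseteq> binary_forms k" by (simp add: W_set_def honest_def)
  let ?G = "(\<lambda>f. poly f 1) ` F"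
  have "inj_on (\<lambda>f. poly f 1) F"
    using F dehomogenize_inject by (intro inj_onI) blast
  then have "card ?G = card F" by (rule card_image)
  moreover have "\<forall>g\<in>?G. degree g \<le> k" using F by (auto intro: degree_dehomogenize)
  moreover have "dependent_powers d ?G" "card F = r"
    using W unfolding W_set_iff_dependent_powers[OF F assms] by simp_all
  ultimately show "\<exists>G. dependent_powers d G \<and> (\<forall>g\<in>G. degree g \<le> k) \<and> card G = r"
    by (intro exI[of _ ?G]) simp
next
  assume "\<exists>G. dependent_powers d G \<and> (\<forall>g\<in>G. degree g \<le> k) \<and> card G = r"
  then obtain G where G: "dependent_powers d G" "\<forall>g\<in>G. degree g \<le> k" "card G = r" by blast
  let ?F = "homogenize k ` G"
  have F: "?F \<subseteq> binary_forms k" using homogenize_in_binary_forms by blast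
  have deh: "poly (homogenize k g) 1 = g" if "g \<in> G" for g
    using G(2) that by (intro dehomogenize_homogenize) simp
  have image: "(\<lambda>f. poly f 1) ` ?F = G" unfolding image_image using deh by simp
  have "card ?F = card G"
    by (rule card_image, rule inj_onI) (metis deh)
  then have "W_set k r d ?F"
    unfolding W_set_iff_dependent_powers[OF F assms] image using G by simp
  then show "\<exists>F. W_set k r d F" ..
qed

lemma Phi_le_card:
  assumes "dependent_powers d G" "\<And>g. g \<in> G \<Longrightarrow> degree g \<le> k" "d \<ge> 1"
  shows "\<Phi> k d \<le> card G"
  unfolding \<Phi>_def using assms ex_W_set_iff[of d k "card G"] by (intro Least_le) blast

lemma Phi_attained:
  assumes "dependent_powers d G" "\<And>g. g \<in> G \<Longrightarrow> degree g \<le> k" "d \<ge> 1"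
  obtains G' where "dependent_powers d G'" "\<And>g. g \<in> G' \<Longrightarrow> degree g \<le> k" "card G' = \<Phi> k d"
proof -
  have "\<exists>r F. W_set k r d F" using assms ex_W_set_iff[of d k "card G"] by blast
  then have "\<exists>F. W_set k (\<Phi> k d) d F" unfolding \<Phi>_def by (rule LeastI_ex)
  then show thesis using ex_W_set_iff[OF assms(3)] that by blast
qed

text \<open>
  Constructions are stated for indexed families, so that members are distinguished by their index
  and only non-proportionality has to be checked.
\<close>

lemma Phi_le_family:
  fixes g :: "'i \<Rightarrow> complex poly"
  assumes "finite I" "d \<ge> 1"
    and g: "\<And>i. i \<in> I \<Longrightarrow> g i \<noteq> 0" "\<And>i. i \<in> I \<Longrightarrow> degree (g i) \<le> k"
    and nonprop: "\<And>i j c. i \<in> I \<Longrightarrow> j \<in> I \<Longrightarrow> i \<noteq> j \<Longrightarrow> g i \<noteq> smult c (g j)"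
    and c: "\<exists>i\<in>I. c i \<noteq> 0" "(\<Sum>i\<in>I. smult (c i) (g i ^ d)) = 0"
  shows "dependent_powers d (g ` I)" "\<Phi> k d \<le> card I"
proof -
  have inj: "inj_on g I"
    using nonprop[where c = 1] by (intro inj_onI) (metis smult_1_left)
  define c' where "c' p = c (the_inv_into I g p)" for p
  have c': "c' (g i) = c i" if "i \<in> I" for i
    using the_inv_into_f_f[OF inj that] by (simp add: c'_def)
  have c'_relation: "(\<exists>p\<in>g ` I. c' p \<noteq> 0) \<and> (\<Sum>p\<in>g ` I. smult (c' p) (p ^ d)) = 0"
    using c by (simp add: sum.reindex[OF inj] c')
  have "g i \<noteq> smult a (g j)" if "i \<in> I" "j \<in> I" "g i \<noteq> g j" for i j a
    using that by (intro nonprop) auto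
  then have "\<forall>p\<in>g ` I. \<forall>q\<in>g ` I. p \<noteq> q \<longrightarrow> (\<forall>c. p \<noteq> smult c q)" by (intro ballI) auto
  moreover have "0 \<notin> g ` I" using g(1) by auto
  ultimately show dep: "dependent_powers d (g ` I)"
    unfolding dependent_powers_def using assms(1) c'_relation by (intro conjI exI[of _ c']) simp_all
  have "\<Phi> k d \<le> card (g ` I)"
    using g(2) \<open>d \<ge> 1\<close> by (intro Phi_le_card[OF dep]) auto
  then show "\<Phi> k d \<le> card I" by (simp add: card_image inj)
qed

section \<open>Constructions from roots of unity\<close>

lemma primitive_root_of_unity:
  assumes "m \<ge> (1 :: nat)"
  obtains \<omega> :: complex where "\<And>s. \<omega> ^ s = 1 \<longleftrightarrow> m dvd s"
proof -
  define \<omega> where "\<omega> = cis (2 * pi / real m)"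
  have pow: "\<omega> ^ k = cis (2 * pi * real k / real m)" for k
    by (simp add: \<omega>_def DeMoivre mult_ac)
  \<comment> \<open>distinctness of the \<open>m\<close> roots is what makes \<open>\<omega>\<close> primitive\<close>
  have bij: "bij_betw (\<lambda>k. \<omega> ^ k) {..<m} {z. z ^ m = 1}"
    unfolding pow using assms by (intro bij_betw_roots_unity) simp
  have one: "\<omega> ^ m = 1" using assms by (simp add: pow)
  have "\<omega> ^ s = 1 \<longleftrightarrow> m dvd s" for s
  proof -
    have "\<omega> ^ s = \<omega> ^ (m * (s div m) + s mod m)" by simp
    also have "\<dots> = \<omega> ^ (s mod m)" unfolding power_add power_mult one by simp
    finally have "\<omega> ^ s = 1 \<longleftrightarrow> \<omega> ^ (s mod m) = \<omega> ^ 0" by simp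
    also have "\<dots> \<longleftrightarrow> s mod m = 0"
      using bij assms by (subst inj_on_eq_iff[of _ "{..<m}"]) (auto simp: bij_betw_def)
    finally show ?thesis by (simp add: dvd_eq_mod_eq_0)
  qed
  then show thesis by (rule that)
qed

context
  fixes \<omega> :: complex and m :: nat
  assumes \<omega>: "\<And>s. \<omega> ^ s = 1 \<longleftrightarrow> m dvd s" and m: "m \<ge> 1"
begin

lemma root_of_unity_nonzero: "\<omega> \<noteq> 0"
  using \<omega>[of m] m by (auto simp: power_0_left)

lemma root_of_unity_power_inject:
  assumes "i < m" "j < m" "\<omega> ^ i = \<omega> ^ j"
  shows "i = j"
  using assms
proof (induction i j rule: linorder_wlog)
  case (le i j)
  have "\<omega> ^ i * \<omega> ^ (j - i) = \<omega> ^ j" using le by (subst power_add[symmetric]) simp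
  then have "\<omega> ^ i * \<omega> ^ (j - i) = \<omega> ^ i * 1" using le by simp
  then have "m dvd j - i" using root_of_unity_nonzero \<omega> by simp
  then show ?case using le by (metis diff_is_0_eq dvd_imp_le le_antisym less_imp_diff_less not_le zero_less_iff_neq_zero)
qed auto

text \<open>
  This is what selects, in a sum over rotations, the monomials whose exponent is divisible by \<open>m\<close>.
\<close>

lemma root_of_unity_filter: "(\<Sum>j<m. \<omega> ^ (j * s)) = (if m dvd s then of_nat m else 0)"
proof (cases "m dvd s")
  case True
  then have "\<omega> ^ (j * s) = 1" for j using \<omega> by simp
  then show ?thesis using True by simp
next
  case False
  then have "\<omega> ^ s \<noteq> 1" using \<omega> by simp
  have "(\<Sum>j<m. \<omega> ^ (j * s)) = (\<Sum>j<m. (\<omega> ^ s) ^ j)"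
    by (simp add: mult.commute flip: power_mult)
  also have "\<dots> = ((\<omega> ^ s) ^ m - 1) / (\<omega> ^ s - 1)"
    using \<open>\<omega> ^ s \<noteq> 1\<close> by (simp add: geometric_sum)
  also have "(\<omega> ^ s) ^ m = 1"
    unfolding power_mult[symmetric] \<omega> by simp
  finally show ?thesis using False by simp
qed

end

text \<open>
  The weights cancel \<open>(X^e + \<omega>^j)^d\<close>, summed over \<open>j\<close>, against powers of monomials: the surviving
  terms have \<open>i = m * u\<close>, and \<open>e * (d - m * u) = d * (e - u * t)\<close> because \<open>e * m = t * d\<close>. The parameter
  \<open>t\<close> trades \<open>m = t * (d div e)\<close> binomials for \<open>e div t + 1\<close> monomials.
\<close>

lemma roots_of_unity_family:
  assumes "e dvd d" "e \<ge> 1" "d \<ge> 1" "t \<ge> 1"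
  shows "\<exists>G. dependent_powers d G \<and> (\<forall>g\<in>G. degree g \<le> e)"
    and "\<Phi> e d \<le> 1 + (t * (d div e) + e div t)"
proof -
  define q where "q = d div e"
  have d: "d = e * q" and "q \<ge> 1" using assms(1,3) by (auto simp: q_def Suc_le_eq dvd_div_eq_0_iff)
  define m where "m = t * q"
  have "m \<ge> 1" using \<open>q \<ge> 1\<close> assms(4) by (simp add: m_def)
  obtain \<omega> :: complex where \<omega>: "\<And>s. \<omega> ^ s = 1 \<longleftrightarrow> m dvd s"
    using primitive_root_of_unity[OF \<open>m \<ge> 1\<close>] by blast
  have \<omega>0: "\<omega> \<noteq> 0" using root_of_unity_nonzero[OF \<omega> \<open>m \<ge> 1\<close>] .
  let ?I = "{..<m} <+> {..e div t}"
  define g where "g = case_sum (\<lambda>j. monom 1 e + [:\<omega> ^ j:]) (\<lambda>u. monom 1 (e - u * t))"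
  define c where "c = case_sum (\<lambda>j :: nat. 1) (\<lambda>u. - of_nat (m * (d choose (m * u))) :: complex)"
  have ut: "u * t \<le> e" if "u \<le> e div t" for u
    using that assms(4) by (meson div_times_less_eq_dividend le_trans mult_le_mono1)
  have coeff_Inl: "coeff (g (Inl j)) e = 1" "coeff (g (Inl j)) 0 = \<omega> ^ j" for j
    using assms(2) by (simp_all add: g_def coeff_pCons split: nat.split)
  have coeff_Inr: "coeff (g (Inr u)) i = (if e - u * t = i then 1 else 0)" for u i
    by (simp add: g_def)
  have power_Inl: "g (Inl j) ^ d = (\<Sum>i\<le>d. monom (of_nat (d choose i) * \<omega> ^ (j * i)) (e * (d - i)))" for j
  proof -
    have "g (Inl j) ^ d = ([:\<omega> ^ j:] + monom 1 e) ^ d" by (simp add: g_def add.commute)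
    also have "\<dots> = (\<Sum>i\<le>d. of_nat (d choose i) * [:\<omega> ^ j:] ^ i * monom 1 e ^ (d - i))"
      by (rule binomial_ring)
    also have "\<dots> = (\<Sum>i\<le>d. monom (of_nat (d choose i) * \<omega> ^ (j * i)) (e * (d - i)))"
      by (intro sum.cong refl)
        (simp add: monom_power poly_const_pow of_nat_poly smult_monom power_mult)
    finally show ?thesis .
  qed
  have m_le: "m * u \<le> d \<longleftrightarrow> u \<le> e div t" for u
  proof -
    have "m * u \<le> d \<longleftrightarrow> (u * t) * q \<le> e * q" unfolding m_def d by (simp add: ac_simps)
    also have "\<dots> \<longleftrightarrow> u * t \<le> e" using \<open>q \<ge> 1\<close> by simp
    also have "\<dots> \<longleftrightarrow> u \<le> e div t" using assms(4) by (simp add: less_eq_div_iff_mult_less_eq)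
    finally show ?thesis .
  qed
  have "(\<Sum>j<m. g (Inl j) ^ d) = (\<Sum>i\<le>d. \<Sum>j<m. monom (of_nat (d choose i) * \<omega> ^ (j * i)) (e * (d - i)))"
    unfolding power_Inl by (rule sum.swap)
  also have "\<dots> = (\<Sum>i\<le>d. monom (of_nat (d choose i) * (\<Sum>j<m. \<omega> ^ (j * i))) (e * (d - i)))"
    by (simp add: monom_sum sum_distrib_left)
  also have "\<dots> = (\<Sum>i\<le>d. if m dvd i then monom (of_nat (m * (d choose i))) (e * (d - i)) else 0)"
    unfolding root_of_unity_filter[OF \<omega> \<open>m \<ge> 1\<close>] by (intro sum.cong refl) (simp add: mult.commute)
  also have "\<dots> = (\<Sum>i\<in>{i. i \<le> d \<and> m dvd i}. monom (of_nat (m * (d choose i))) (e * (d - i)))"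
    by (simp add: sum.inter_filter[symmetric])
  also have "\<dots> = (\<Sum>u\<le>e div t. monom (of_nat (m * (d choose (m * u)))) (e * (d - m * u)))"
    by (rule sum.reindex_bij_witness[of _ "\<lambda>u. m * u" "\<lambda>i. i div m"]) (use \<open>m \<ge> 1\<close> in \<open>auto simp: m_le\<close>)
  also have "\<dots> = (\<Sum>u\<le>e div t. smult (of_nat (m * (d choose (m * u)))) (g (Inr u) ^ d))"
  proof (intro sum.cong refl)
    fix u assume "u \<in> {..e div t}"
    have "e * (d - m * u) = (e - u * t) * d"
      unfolding m_def d by (simp add: algebra_simps diff_mult_distrib2)
    then show "monom (of_nat (m * (d choose (m * u)))) (e * (d - m * u))
        = smult (of_nat (m * (d choose (m * u)))) (g (Inr u) ^ d)"
      by (simp add: g_def monom_power smult_monom)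
  qed
  finally have relation: "(\<Sum>i\<in>?I. smult (c i) (g i ^ d)) = 0"
    by (simp add: sum.Plus c_def sum_negf)
  have nonprop: "g i \<noteq> smult a (g j)" if "i \<in> ?I" "j \<in> ?I" "i \<noteq> j" for i j a
  proof
    assume "g i = smult a (g j)"
    then have eq: "coeff (g i) l = a * coeff (g j) l" for l by simp
    show False
    proof (cases i; cases j)
      fix i' j' assume [simp]: "i = Inl i'" "j = Inl j'"
      have "\<omega> ^ i' = \<omega> ^ j'" using eq[of e] eq[of 0] by (simp add: coeff_Inl)
      then show False using root_of_unity_power_inject[OF \<omega> \<open>m \<ge> 1\<close>, of i' j'] that by auto
    next
      fix i' j' assume [simp]: "i = Inl i'" "j = Inr j'"
      show False using eq[of e] eq[of 0] \<omega>0 assms(2) by (auto simp: coeff_Inl coeff_Inr split: if_splits)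
    next
      fix i' j' assume [simp]: "i = Inr i'" "j = Inl j'"
      show False using eq[of e] eq[of 0] eq[of "e - i' * t"] \<omega>0 assms(2) by (auto simp: coeff_Inl coeff_Inr split: if_splits)
    next
      fix i' j' assume ij[simp]: "i = Inr i'" "j = Inr j'"
      have "e - i' * t = e - j' * t" using eq[of "e - i' * t"] by (auto simp: coeff_Inr split: if_splits)
      moreover have "i' * t \<le> e" "j' * t \<le> e" using ut that by auto
      ultimately have "i' * t = j' * t" by (metis diff_diff_cancel)
      then show False using that assms(4) by simp
    qed
  qed
  have deg: "degree (g i) \<le> e" for i
    by (cases i) (auto simp: g_def degree_monom_eq intro!: degree_add_le)
  have g0: "g i \<noteq> 0" for i
  proof
    assume "g i = 0"
    then have "coeff (g i) l = 0" for l by simp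
    from this[of e] this[of "e - projr i * t"] show False
      by (cases i) (auto simp: coeff_Inl coeff_Inr)
  qed
  have c: "\<exists>i\<in>?I. c i \<noteq> 0" using \<open>m \<ge> 1\<close> by (intro bexI[of _ "Inl 0"]) (auto simp: c_def)
  have fin: "finite ?I" by simp
  note family = Phi_le_family[OF fin \<open>d \<ge> 1\<close> g0 deg nonprop c relation]
  show "\<exists>G. dependent_powers d G \<and> (\<forall>g\<in>G. degree g \<le> e)"
    using family(1) deg by blast
  have "card ?I = 1 + (t * (d div e) + e div t)"
    by (simp add: card_Plus m_def q_def)
  with family(2) show "\<Phi> e d \<le> 1 + (t * (d div e) + e div t)" by simp
qed

lemma pcompose_power: "pcompose p q ^ n = pcompose (p ^ n) (q :: complex poly)"
  by (induction n) (simp_all add: pcompose_mult one_pCons)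

text \<open>
  The weights \<open>\<omega>^(j * (m - 1) * d)\<close> stand for \<open>\<omega>^(- j * d)\<close>, since \<open>\<omega>^m = 1\<close>. They shift the filter so
  that it keeps the exponents congruent to \<open>d\<close> modulo \<open>m\<close>. If among these only \<open>d\<close> itself occurs, the
  sum is a multiple of \<open>X ^ d\<close>, which one further member \<open>X\<close> cancels.
\<close>

lemma Phi_2_le_rotation_orbit:
  assumes "\<alpha> \<noteq> 0" "\<beta> \<noteq> 0" "m \<ge> 1" "d \<ge> 1"
    and vanish: "\<And>i. i \<noteq> d \<Longrightarrow> m dvd i + (m - 1) * d \<Longrightarrow> coeff ([:\<beta>, \<alpha>, 1:] ^ d) i = (0 :: complex)"
  shows "\<Phi> 2 d \<le> m + 1"
proof -
  obtain \<omega> :: complex where \<omega>: "\<And>s. \<omega> ^ s = 1 \<longleftrightarrow> m dvd s"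
    using primitive_root_of_unity[OF \<open>m \<ge> 1\<close>] by blast
  let ?P = "[:\<beta>, \<alpha>, 1:]"
  let ?I = "{..<m} <+> {()}"
  define g where "g = case_sum (\<lambda>j. pcompose ?P [:0, \<omega> ^ j:]) (\<lambda>_ :: unit. monom 1 1)"
  define c where "c = case_sum (\<lambda>j. \<omega> ^ (j * ((m - 1) * d))) (\<lambda>_ :: unit. - (of_nat m * coeff (?P ^ d) d))"
  have coeff_Inl: "coeff (g (Inl j)) i = (\<omega> ^ j) ^ i * coeff ?P i" for i j
    by (simp add: g_def coeff_pcompose_linear)
  have relation: "(\<Sum>i\<in>?I. smult (c i) (g i ^ d)) = 0"
  proof (rule poly_eqI)
    fix i
    have "coeff (g (Inl j) ^ d) i = \<omega> ^ (j * i) * coeff (?P ^ d) i" for j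
      by (simp add: g_def coeff_pcompose_linear power_mult pcompose_power)
    then have "coeff (\<Sum>i\<in>?I. smult (c i) (g i ^ d)) i
        = (\<Sum>j<m. \<omega> ^ (j * (i + (m - 1) * d)) * coeff (?P ^ d) i)
          - of_nat m * coeff (?P ^ d) d * (if i = d then 1 else 0)"
      by (simp add: sum.Plus coeff_sum c_def g_def monom_power power_add distrib_left mult_ac)
    also have "\<dots> = (if m dvd i + (m - 1) * d then of_nat m else 0) * coeff (?P ^ d) i
          - of_nat m * coeff (?P ^ d) d * (if i = d then 1 else 0)"
      unfolding root_of_unity_filter[OF \<omega> \<open>m \<ge> 1\<close>, symmetric] by (simp add: sum_distrib_right)
    also have "\<dots> = 0"
    proof (cases "i = d")
      case True
      have "d + (m - 1) * d = m * d" using \<open>m \<ge> 1\<close> by (cases m) auto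
      then show ?thesis using True by simp
    qed (use vanish in auto)
    finally show "coeff (\<Sum>i\<in>?I. smult (c i) (g i ^ d)) i = coeff 0 i" by simp
  qed
  have nonprop: "g i \<noteq> smult a (g j)" if "i \<in> ?I" "j \<in> ?I" "i \<noteq> j" for i j a
  proof
    assume "g i = smult a (g j)"
    then have eq: "coeff (g i) l = a * coeff (g j) l" for l by simp
    show False
    proof (cases i; cases j)
      fix i' j' assume [simp]: "i = Inl i'" "j = Inl j'"
      have "\<omega> ^ i' = \<omega> ^ j'" using eq[of 0] eq[of 1] assms(1,2) by (simp add: coeff_Inl)
      then show False using root_of_unity_power_inject[OF \<omega> \<open>m \<ge> 1\<close>, of i' j'] that by auto
    next
      fix i' and j' :: unit assume [simp]: "i = Inl i'" "j = Inr j'"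
      show False using eq[of 0] assms(2) by (simp add: coeff_Inl) (simp add: g_def)
    next
      fix i' :: unit and j' assume [simp]: "i = Inr i'" "j = Inl j'"
      have "a = 0" using eq[of 0] assms(2) by (simp add: coeff_Inl) (simp add: g_def)
      then show False using eq[of 1] by (simp add: g_def)
    next
      fix i' j' :: unit assume "i = Inr i'" "j = Inr j'"
      then show False using that by simp
    qed
  qed
  have deg: "degree (g i) \<le> 2" for i
    by (cases i) (auto simp: g_def degree_pcompose degree_monom_eq intro: order_trans[OF degree_pcompose_le])
  have g0: "g i \<noteq> 0" for i
  proof
    assume "g i = 0"
    then have "coeff (g i) l = 0" for l by simp
    from this[of 0] this[of 1] show False
      using assms(2) by (cases i) (simp add: coeff_Inl, simp add: g_def)
  qed
  have c: "\<exists>i\<in>?I. c i \<noteq> 0"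
    using \<open>m \<ge> 1\<close> by (intro bexI[of _ "Inl 0"]) (auto simp: c_def)
  have fin: "finite ?I" by simp
  have "\<Phi> 2 d \<le> card ?I"
    by (rule Phi_le_family(2)[OF fin \<open>d \<ge> 1\<close> g0 deg nonprop c relation])
  then show ?thesis by (simp add: card_Plus)
qed

lemma ex_nonzero_root:
  fixes Q :: "complex poly"
  assumes "coeff Q i \<noteq> 0" "coeff Q j \<noteq> 0" "i \<noteq> j"
  shows "\<exists>z. z \<noteq> 0 \<and> poly Q z = 0"
proof -
  have "Q \<noteq> 0" using assms(1) by auto
  then obtain R where R: "Q = [:- 0, 1:] ^ order 0 Q * R" "\<not> [:- 0, 1:] dvd R"
    using order_decomp by blast
  have R0: "poly R 0 \<noteq> 0" using R(2) unfolding poly_eq_0_iff_dvd .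
  \<comment> \<open>otherwise \<open>Q\<close> would be a monomial, with only one nonzero coefficient\<close>
  have "degree R \<noteq> 0"
  proof
    assume "degree R = 0"
    then obtain c where "R = [:c:]" by (rule degree_eq_zeroE)
    then have "Q = monom c (order 0 Q)" using R(1) by (simp add: monom_altdef)
    then have "coeff Q l = (if order 0 Q = l then c else 0)" for l by (metis coeff_monom)
    then show False using assms by (metis (no_types))
  qed
  then have "\<not> constant (poly R)" by (simp add: constant_degree)
  then obtain z where z: "poly R z = 0" using fundamental_theorem_of_algebra by blast
  then have "z \<noteq> 0" using R0 by auto
  moreover have "poly Q z = 0" by (subst R(1)) (simp add: z)
  ultimately show ?thesis by blast
qed

lemma coeff_power_quadratic_2: "coeff ([:1, 0, 1 :: complex:] ^ n) 2 = of_nat n"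
  by (induction n) (simp_all add: eval_nat_numeral coeff_0_power)

text \<open>
  As a polynomial in \<open>\<alpha>\<close>, the coefficient contains \<open>\<alpha> ^ N\<close> and \<open>\<alpha> ^ (N - 2)\<close>, so it is not a
  monomial and has a nonzero root.
\<close>

lemma ex_vanishing_coefficient:
  assumes "2 \<le> N" "N \<le> d"
  shows "\<exists>\<alpha> :: complex. \<alpha> \<noteq> 0 \<and> coeff ([:1, \<alpha>, 1:] ^ d) N = 0"
proof -
  let ?B = "[:1, 0, 1 :: complex:]"
  define q where "q c = of_nat (d choose c) * coeff (?B ^ (d - c)) (N - c)" for c
  define Q where "Q = (\<Sum>c\<le>N. monom (q c) c)"
  have coeff_Q: "coeff Q c = q c" if "c \<le> N" for c
    using that by (simp add: Q_def coeff_sum)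
  have "q N \<noteq> 0" using assms by (simp add: q_def coeff_0_power)
  moreover have "q (N - 2) \<noteq> 0"
  proof -
    have "N - (N - 2) = 2" "d - (N - 2) \<noteq> 0" "N - 2 \<le> d" using assms by auto
    then show ?thesis
      by (simp add: q_def coeff_power_quadratic_2 of_nat_eq_0_iff del: of_nat_diff diff_is_0_eq)
  qed
  ultimately obtain \<alpha> where \<alpha>: "\<alpha> \<noteq> 0" "poly Q \<alpha> = 0"
  proof -
    assume "q N \<noteq> 0" "q (N - 2) \<noteq> 0"
    then have "coeff Q N \<noteq> 0" "coeff Q (N - 2) \<noteq> 0" using coeff_Q by simp_all
    moreover have "N \<noteq> N - 2" using assms(1) by simp
    ultimately show ?thesis using ex_nonzero_root that by blast
  qed
  have "[:1, \<alpha>, 1:] ^ d = (monom \<alpha> 1 + ?B) ^ d" by (simp add: monom_altdef)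
  also have "\<dots> = (\<Sum>c\<le>d. of_nat (d choose c) * monom \<alpha> 1 ^ c * ?B ^ (d - c))"
    by (rule binomial_ring)
  also have "\<dots> = (\<Sum>c\<le>d. monom (of_nat (d choose c) * \<alpha> ^ c) c * ?B ^ (d - c))"
    by (intro sum.cong refl) (simp add: monom_power of_nat_poly smult_monom)
  also have "coeff \<dots> N = (\<Sum>c\<le>d. if c \<le> N then q c * \<alpha> ^ c else 0)"
    unfolding coeff_sum by (intro sum.cong refl) (simp add: coeff_monom_mult q_def)
  also have "\<dots> = (\<Sum>c\<le>N. q c * \<alpha> ^ c)"
    using assms by (intro sum.mono_neutral_cong_right) auto
  also have "\<dots> = poly Q \<alpha>" by (simp add: Q_def poly_sum poly_monom)
  finally show ?thesis using \<alpha> by auto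
qed

text \<open>
  For \<open>m = d div 2 + 1\<close> the only exponents up to \<open>2 * d\<close> congruent to \<open>d\<close> modulo \<open>m\<close> are
  \<open>d - m\<close>, \<open>d\<close> and \<open>d + m\<close>, and the coefficients at \<open>d - m\<close> and \<open>d + m\<close> agree because
  \<open>X\<^sup>2 + \<alpha> X + 1\<close> is palindromic. Here \<open>d \<ge> 5\<close> ensures \<open>d - m \<ge> 2\<close>.
\<close>

lemma Phi_2_le_half:
  assumes "d \<ge> 5"
  shows "\<Phi> 2 d \<le> d div 2 + 2"
proof -
  define m where "m = d div 2 + 1"
  have m: "d < 2 * m" "m + 2 \<le> d" "1 \<le> m" using assms by (auto simp: m_def)
  obtain \<alpha> :: complex where \<alpha>: "\<alpha> \<noteq> 0" "coeff ([:1, \<alpha>, 1:] ^ d) (d - m) = 0"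
  proof -
    have "2 \<le> d - m" "d - m \<le> d" using m by simp_all
    then show ?thesis using ex_vanishing_coefficient that by blast
  qed
  let ?P = "[:1, \<alpha>, 1:] ^ d"
  have deg: "degree ?P = 2 * d" by (simp add: degree_power_eq)
  have "reflect_poly [:1, \<alpha>, 1:] = [:1, \<alpha>, 1:]"
    by (simp add: reflect_poly_def cCons_def)
  then have "reflect_poly ?P = ?P" by (simp add: reflect_poly_power)
  then have "coeff ?P (d + m) = coeff ?P (2 * d - (d + m))"
    using coeff_reflect_poly[of ?P "d + m"] m by (simp add: deg)
  then have sym: "coeff ?P (d + m) = 0" using \<alpha>(2) by (simp add: mult_2)
  have "\<Phi> 2 d \<le> m + 1"
  proof (rule Phi_2_le_rotation_orbit[OF \<alpha>(1)])
    fix i assume i: "i \<noteq> d" "m dvd i + (m - 1) * d"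
    have md: "m * d = d + (m - 1) * d" using m(3) by (cases m) auto
    have mdvd: "m dvd m * d" by simp
    show "coeff ?P i = 0"
    proof (cases "i < d")
      case True
      have "m * d - (i + (m - 1) * d) = d - i" unfolding md using True by simp
      then have "m dvd d - i" using dvd_diff_nat[OF mdvd i(2)] by simp
      then obtain l where "d - i = m * l" ..
      moreover from this have "l = 1"
        using True m(1) by (cases l rule: nat.exhaust; cases "l - 1") auto
      ultimately have "i = d - m" using True by simp
      then show ?thesis using \<alpha> by simp
    next
      case False
      have "(i + (m - 1) * d) - m * d = i - d" unfolding md using False by simp
      then have "m dvd i - d" using dvd_diff_nat[OF i(2) mdvd] by simp
      then obtain l where l: "i - d = m * l" ..
      show ?thesis
      proof (cases "i \<le> 2 * d")
        case True
        with l have "l = 1"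
          using False i(1) m(1) by (cases l rule: nat.exhaust; cases "l - 1") auto
        then have "i = d + m" using False l by simp
        then show ?thesis using sym by simp
      qed (simp add: coeff_eq_0 deg)
    qed
  qed (use m assms in auto)
  then show ?thesis by (simp add: m_def)
qed

text \<open>
  The rotations of \<open>X\<^sup>2 + X - 1\<close> together with \<open>X\<close> are the six axes of a regular icosahedron. The
  suitably weighted fourteenth powers sum to an invariant of degree \<open>28\<close>, and the icosahedral
  invariants, generated in degrees \<open>12\<close>, \<open>20\<close> and \<open>30\<close>, contain none of that degree. Concretely, the
  coefficients at the exponents other than \<open>14\<close> that are congruent to \<open>14\<close> modulo \<open>5\<close> vanish.
\<close>

lemma Phi_2_14_le: "\<Phi> 2 14 \<le> 6"
proof -
  let ?P = "[:-1, 1, 1 :: complex:]"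
  have p2: "?P ^ 2 = [:1, -2, -1, 2, 1:]" by (simp add: power2_eq_square)
  have p3: "?P ^ 3 = [:-1, 3, 0, -5, 0, 3, 1:]"
    unfolding power3_eq_cube by simp
  have "?P ^ 7 = (?P ^ 2) ^ 2 * ?P ^ 3" by (simp flip: power_mult power_add)
  also have "\<dots> = [:-1, 7, -14, -7, 49, -14, -77, 29, 77, -14, -49, -7, 14, 7, 1:]"
    unfolding p2 p3 by (simp add: power2_eq_square)
  finally have p7: "?P ^ 7 = \<dots>" .
  have "?P ^ 14 = ?P ^ 7 * ?P ^ 7" by (simp flip: power_add)
  have vanish: "coeff (?P ^ 14) 4 = 0" "coeff (?P ^ 14) 9 = 0" "coeff (?P ^ 14) 19 = 0" "coeff (?P ^ 14) 24 = 0"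
    unfolding \<open>?P ^ 14 = ?P ^ 7 * ?P ^ 7\<close> p7 by (simp_all add: eval_nat_numeral)
  have "\<Phi> 2 14 \<le> 5 + 1"
  proof (rule Phi_2_le_rotation_orbit[where \<alpha> = 1 and \<beta> = "-1"])
    fix i :: nat assume i: "i \<noteq> 14" "5 dvd i + (5 - 1) * 14"
    show "coeff (?P ^ 14) i = 0"
    proof (cases "i \<le> 28")
      case True
      then have "i = 4 \<or> i = 9 \<or> i = 19 \<or> i = 24" using i by presburger
      then show ?thesis using vanish by auto
    next
      case False
      then show ?thesis by (intro coeff_eq_0) (simp add: degree_power_eq)
    qed
  qed simp_all
  then show ?thesis by simp
qed

lemma Phi_2_le_list:
  assumes "(\<Sum>i<length gs. smult (cs ! i) (gs ! i ^ d)) = (0 :: complex poly)" "cs ! 0 \<noteq> 0" "gs \<noteq> []" "d \<ge> 1"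
    and "\<forall>i<length gs. gs ! i \<noteq> 0 \<and> degree (gs ! i) \<le> 2 \<and>
      (\<forall>j<length gs. i \<noteq> j \<longrightarrow> (\<forall>c. gs ! i \<noteq> smult c (gs ! j)))"
  shows "\<Phi> 2 d \<le> length gs"
  using Phi_le_family(2)[of "{..<length gs}" d "\<lambda>i. gs ! i" 2 "\<lambda>i. cs ! i"] assms by auto

lemma uminus_eq_1_iff: "- c = 1 \<longleftrightarrow> c = (-1 :: complex)"
  by (metis minus_minus)

lemma Phi_2_2_le: "\<Phi> 2 2 \<le> 3"
  using Phi_2_le_list[where gs = "[[:-1, 0, 1:], [:0, 2:], [:1, 0, 1:]]" and cs = "[1, 1, -1]" and d = 2]
  by (simp add: All_less_Suc eval_nat_numeral uminus_eq_1_iff)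

text \<open>
  With \<open>A = X\<^sup>2 - 1\<close>, \<open>(A + X)\<^sup>3 + (A - X)\<^sup>3 = 2 A (A\<^sup>2 + 3 X\<^sup>2) = 2 (X\<^sup>6 - 1)\<close>.
\<close>

lemma Phi_2_3_le: "\<Phi> 2 3 \<le> 4"
  using Phi_2_le_list[where gs = "[[:-1, 1, 1:], [:-1, -1, 1:], [:0, 0, 1:], [:1:]]" and cs = "[1, 1, -2, 2]" and d = 3]
  by (simp add: All_less_Suc eval_nat_numeral uminus_eq_1_iff)

text \<open>
  \<open>a\<^sup>4 + b\<^sup>4 + (a + b)\<^sup>4 = 2 (a\<^sup>2 + a b + b\<^sup>2)\<^sup>2\<close>, at a parametrization \<open>a = X\<^sup>2 - 1\<close>, \<open>b = 2 X + 1\<close> that makes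
  \<open>a\<^sup>2 + a b + b\<^sup>2\<close> the square of \<open>X\<^sup>2 + X + 1\<close>.
\<close>

lemma Phi_2_4_le: "\<Phi> 2 4 \<le> 4"
  using Phi_2_le_list[where gs = "[[:-1, 0, 1:], [:1, 2:], [:0, 2, 1:], [:1, 1, 1:]]" and cs = "[1, 1, 1, -2]" and d = 4]
  by (simp add: All_less_Suc eval_nat_numeral uminus_eq_1_iff)

section \<open>The function \<open>\<Theta>\<close>\<close>

text \<open>
  For \<open>s\<close> the floor of the root, \<open>s \<le> m\<close> means \<open>4 d + 1 < (m + 1)\<^sup>2\<close>. The lower bound is the
  inequality of the means applied to \<open>t\<close> and \<open>d div t + 1\<close>, whose product exceeds \<open>d\<close>; the value
  \<open>t = (s + 1) div 2\<close> makes \<open>t * (s + 1 - t)\<close> as large as possible.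
\<close>

lemma min_theta_term_eq_floor_sqrt:
  fixes d :: nat
  shows "t \<ge> 1 \<Longrightarrow> nat \<lfloor>sqrt (4 * real d + 1)\<rfloor> \<le> t + d div t"
    and "\<exists>t\<ge>1. t + d div t \<le> nat \<lfloor>sqrt (4 * real d + 1)\<rfloor>"
proof -
  define s where "s = nat \<lfloor>sqrt (4 * real d + 1)\<rfloor>"
  have s_le: "s \<le> m \<longleftrightarrow> 4 * d + 1 < (m + 1)\<^sup>2" for m
  proof -
    have "s \<le> m \<longleftrightarrow> sqrt (4 * real d + 1) < real m + 1"
      unfolding s_def by (simp add: nat_le_iff floor_le_iff)
    also have "\<dots> \<longleftrightarrow> 4 * real d + 1 < (real m + 1)\<^sup>2"
      using real_sqrt_less_iff[of "4 * real d + 1" "(real m + 1)\<^sup>2"] by simp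
    also have "\<dots> \<longleftrightarrow> real (4 * d + 1) < real ((m + 1)\<^sup>2)" by (simp add: add.commute)
    finally show ?thesis by (simp only: of_nat_less_iff)
  qed
  show "s \<le> t + d div t" if "t \<ge> 1"
  proof -
    define a where "a = d div t + 1"
    have "d < t * a" unfolding a_def using that dividend_less_times_div[of t d] by (simp add: algebra_simps)
    then have "4 * d + 4 \<le> 4 * (t * a)" by simp
    also have "\<dots> \<le> (t + a)\<^sup>2"
    proof -
      have "0 \<le> (int t - int a)\<^sup>2" by simp
      then have "int (4 * (t * a)) \<le> int ((t + a)\<^sup>2)" by (simp add: power2_eq_square algebra_simps)
      then show ?thesis by (simp only: of_nat_le_iff)
    qed
    finally have "4 * d + 1 < (t + d div t + 1)\<^sup>2" by (simp add: a_def)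
    then show ?thesis unfolding s_le .
  qed
  show "\<exists>t\<ge>1. t + d div t \<le> s"
  proof (intro exI conjI)
    have s: "4 * d + 1 < (s + 1)\<^sup>2" using s_le[of s] by simp
    then have "s \<ge> 1" by (cases s) auto
    define t where "t = (s + 1) div 2"
    show "t \<ge> 1" using \<open>s \<ge> 1\<close> by (simp add: t_def)
    have "t \<le> s" using \<open>s \<ge> 1\<close> by (simp add: t_def)
    have "d < t * (s + 1 - t)"
    proof (cases "even (s + 1)")
      case True
      then obtain l where "s + 1 = 2 * l" ..
      then show ?thesis using s by (simp add: t_def power2_eq_square)
    next
      case False
      then obtain l where l: "s + 1 = 2 * l + 1" by (rule oddE)
      then have "t = l" "s + 1 - t = l + 1" by (simp_all add: t_def)
      moreover have "4 * d + 1 < 4 * (l * (l + 1)) + 1"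
        using s unfolding l by (simp add: power2_eq_square algebra_simps)
      ultimately show ?thesis by simp
    qed
    then have "d div t < s + 1 - t"
      using \<open>t \<ge> 1\<close> by (simp add: less_mult_imp_div_less mult.commute)
    then show "t + d div t \<le> s" using \<open>t \<le> s\<close> by simp
  qed
qed

lemma Theta_attained: "\<exists>t\<ge>1. \<Theta> e d = 1 + (t * (d div e) + e div t)"
proof -
  have "(INF t\<in>{1..}. t * (d div e) + e div t) \<in> (\<lambda>t. t * (d div e) + e div t) ` {1..}"
    by (rule Inf_nat_def1) auto
  then show ?thesis unfolding \<Theta>_def by auto
qed

lemma Theta_le: "t \<ge> 1 \<Longrightarrow> \<Theta> e d \<le> 1 + (t * (d div e) + e div t)"
  unfolding \<Theta>_def by (intro add_left_mono cINF_lower) auto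

lemma Theta_self:
  assumes "d \<ge> 1"
  shows "int (\<Theta> d d) = 1 + \<lfloor>sqrt (4 * real d + 1)\<rfloor>"
proof -
  let ?s = "nat \<lfloor>sqrt (4 * real d + 1)\<rfloor>"
  have "d div d = 1" using assms by simp
  obtain t where "t \<ge> 1" "\<Theta> d d = 1 + (t * (d div d) + d div t)" using Theta_attained by blast
  then have "1 + ?s \<le> \<Theta> d d" using min_theta_term_eq_floor_sqrt(1)[of t d] \<open>d div d = 1\<close> by simp
  moreover obtain t where "t \<ge> 1" "t + d div t \<le> ?s" using min_theta_term_eq_floor_sqrt(2) by blast
  then have "\<Theta> d d \<le> 1 + ?s" using Theta_le[of t d d] \<open>d div d = 1\<close> by simp
  ultimately show ?thesis by simp
qed

section \<open>Bounds for \<open>\<Phi>\<close>\<close>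

text \<open>
  Linear forms with dependent powers exist by the roots-of-unity construction with \<open>e = t = 1\<close>.
  Hence the least \<open>r\<close> in the definition of \<open>\<Phi>\<close> is attained.
\<close>

lemma Phi_realized:
  assumes "k \<ge> 1" "d \<ge> 1"
  obtains G where "dependent_powers d G" "\<And>g. g \<in> G \<Longrightarrow> degree g \<le> k" "card G = \<Phi> k d"
proof -
  obtain G where G: "dependent_powers d G" "\<forall>g\<in>G. degree g \<le> 1"
    using roots_of_unity_family(1)[of 1 d 1] assms by auto
  have "degree g \<le> k" if "g \<in> G" for g
    using G(2) that assms(1) by force
  from Phi_attained[OF G(1) this assms(2)] show thesis using that by blast
qed

lemma Phi_antimono:
  assumes "1 \<le> k" "k \<le> l" "d \<ge> 1"
  shows "\<Phi> l d \<le> \<Phi> k d"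
proof -
  obtain G where G: "dependent_powers d G" "\<And>g. g \<in> G \<Longrightarrow> degree g \<le> k" "card G = \<Phi> k d"
    using Phi_realized[OF assms(1,3)] by blast
  have "degree g \<le> l" if "g \<in> G" for g
    using G(2)[OF that] assms(2) by simp
  from Phi_le_card[OF G(1) this assms(3)] show ?thesis by (simp add: G(3))
qed

lemma Phi_lower_bound:
  assumes "k \<ge> 1" "d \<ge> 1"
  shows "\<exists>n. 2 \<le> n \<and> n < \<Phi> k d \<and> d + 1 < n ^ 2"
  using Phi_realized[OF assms] dependent_powers_card_gt assms(2) by metis

lemma Phi_ge_3: "k \<ge> 1 \<Longrightarrow> d \<ge> 1 \<Longrightarrow> \<Phi> k d \<ge> 3"
  using Phi_lower_bound[of k d] by auto

lemma Phi_gt_sqrt: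
  assumes "k \<ge> 1" "d \<ge> 1"
  shows "real (\<Phi> k d) > 1 + sqrt (real d + 1)"
proof -
  obtain n where n: "n < \<Phi> k d" "d + 1 < n ^ 2" using Phi_lower_bound[OF assms] by blast
  have "real (d + 1) < real (n ^ 2)" using n(2) by (simp only: of_nat_less_iff)
  then have "sqrt (real d + 1) < sqrt ((real n)\<^sup>2)" by (intro real_sqrt_less_mono) (simp add: add.commute)
  then show ?thesis using n(1) by simp
qed

lemma Phi_ge_4:
  assumes "k \<ge> 1" "d \<ge> 3"
  shows "\<Phi> k d \<ge> 4"
proof -
  obtain n where n: "n < \<Phi> k d" "d + 1 < n ^ 2" using Phi_lower_bound[of k d] assms by auto
  have "\<not> n \<le> 2" using n(2) assms(2) power_mono[of n 2 2] by auto
  then show ?thesis using n(1) by simp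
qed

lemma Phi_2_ge_5:
  assumes "d \<ge> 6"
  shows "\<Phi> 2 d \<ge> 5"
proof -
  have "1 \<le> (2 :: nat)" "1 \<le> d" using assms by simp_all
  from Phi_realized[OF this] obtain G
    where "dependent_powers d G" "\<And>g. g \<in> G \<Longrightarrow> degree g \<le> 2" "card G = \<Phi> 2 d"
    by blast
  then show ?thesis using quadratic_dependent_powers_card_ge_5[of d G] assms by simp
qed

lemma Phi_le_Theta:
  assumes "e dvd d" "e \<ge> 1" "d \<ge> 1"
  shows "\<Phi> e d \<le> \<Theta> e d"
  using Theta_attained[of e d] roots_of_unity_family(2)[OF assms] by metis

theorem theorem1p3:
  shows "(\<forall>k d. k \<ge> 1 \<and> d \<ge> 1 \<longrightarrow> \<Phi> (k + 1) d \<le> \<Phi> k d)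
    \<and> (\<forall>k\<ge>2. \<Phi> k 2 = 3)
    \<and> (\<forall>k d. k \<ge> 1 \<and> d \<ge> 3 \<longrightarrow> \<Phi> k d \<ge> 4)
    \<and> (\<forall>k d. k \<ge> 1 \<and> d \<ge> 3 \<longrightarrow> real (\<Phi> k d) > 1 + sqrt (real d + 1))
    \<and> (\<forall>d\<ge>1. \<Phi> d d \<le> \<Theta> d d \<and> int (\<Theta> d d) = 1 + \<lfloor>sqrt (4 * real d + 1)\<rfloor>)
    \<and> (\<forall>e d. e \<ge> 1 \<and> d \<ge> 1 \<and> e dvd d \<longrightarrow> \<Phi> e d \<le> Min {\<Theta> k d | k. 1 \<le> k \<and> k \<le> e \<and> k dvd d})
    \<and> (\<forall>d\<in>{3, 4, 5}. \<forall>k\<ge>2. \<Phi> k d = 4)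
    \<and> (\<forall>d\<ge>6. \<Phi> 2 d \<ge> 5)
    \<and> (\<forall>d\<in>{6, 7}. \<Phi> 2 d = 5)
    \<and> \<Phi> 2 14 \<le> 6
    \<and> (\<forall>d\<ge>4. \<Phi> 2 d \<le> d div 2 + 2)"
proof (intro conjI allI impI ballI)
  show half: "\<Phi> 2 d \<le> d div 2 + 2" if "d \<ge> 4" for d
    using that Phi_2_4_le Phi_2_le_half[of d] by (cases "d = 4") auto
  show "\<Phi> (k + 1) d \<le> \<Phi> k d" if "k \<ge> 1 \<and> d \<ge> 1" for k d
    using that by (intro Phi_antimono) auto
  show "\<Phi> k 2 = 3" if "k \<ge> 2" for k
    using Phi_antimono[of 2 k 2] Phi_2_2_le Phi_ge_3[of k 2] that by simp
  show "\<Phi> k d \<ge> 4" if "k \<ge> 1 \<and> d \<ge> 3" for k d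
    using that by (intro Phi_ge_4) auto
  show "real (\<Phi> k d) > 1 + sqrt (real d + 1)" if "k \<ge> 1 \<and> d \<ge> 3" for k d
    using that by (intro Phi_gt_sqrt) auto
  show "\<Phi> d d \<le> \<Theta> d d" if "d \<ge> 1" for d
    using that by (intro Phi_le_Theta) auto
  show "int (\<Theta> d d) = 1 + \<lfloor>sqrt (4 * real d + 1)\<rfloor>" if "d \<ge> 1" for d
    using that by (rule Theta_self)
  show "\<Phi> e d \<le> Min {\<Theta> k d | k. 1 \<le> k \<and> k \<le> e \<and> k dvd d}" if "e \<ge> 1 \<and> d \<ge> 1 \<and> e dvd d" for e d
  proof (rule Min.boundedI)
    show "finite {\<Theta> k d | k. 1 \<le> k \<and> k \<le> e \<and> k dvd d}" by simp
    show "{\<Theta> k d | k. 1 \<le> k \<and> k \<le> e \<and> k dvd d} \<noteq> {}" using that by auto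
    show "\<Phi> e d \<le> x" if x: "x \<in> {\<Theta> k d | k. 1 \<le> k \<and> k \<le> e \<and> k dvd d}" for x
    proof -
      obtain k where "x = \<Theta> k d" "1 \<le> k" "k \<le> e" "k dvd d" using x by blast
      then show ?thesis
        using Phi_antimono[of k e d] Phi_le_Theta[of k d] \<open>e \<ge> 1 \<and> d \<ge> 1 \<and> e dvd d\<close> by simp
    qed
  qed
  show "\<Phi> k d = 4" if "d \<in> {3, 4, 5}" "k \<ge> 2" for k d
  proof -
    have "\<Phi> 2 d \<le> 4" using that(1) Phi_2_3_le half[of d] by auto
    then show ?thesis using that Phi_antimono[of 2 k d] Phi_ge_4[of k d] by auto
  qed
  show "\<Phi> 2 d \<ge> 5" if "d \<ge> 6" for d
    using that by (rule Phi_2_ge_5)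
  show "\<Phi> 2 d = 5" if "d \<in> {6, 7}" for d
    using that half[of d] Phi_2_ge_5[of d] by auto
  show "\<Phi> 2 14 \<le> 6" by (rule Phi_2_14_le)
qed

end
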